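(* Let $k$ be a commutative ring, let $R$ be a $k$-algebra, and let $\mathsf{A}$ be a $k$-linear cocomplete abelian category. Let $F\in\mathsf{B}_k(\mathsf{Mod}\,R,\mathsf{A})$. Then there is an isomorphism of functors $F\cong -\otimes_R\mathcal{F}$, where $\mathcal{F}=FR$, regarded as an object of $\mathsf{A}_R$ via the $k$-algebra homomorphism $\rho:R\to\mathrm{End}_{\mathsf{A}}(FR)$, $\rho(x)=F(\mu_x)$, with $\mu_x:R\to R$ the right $R$-module homomorphism $\mu_x(r)=xr$.
   Context: $\mathsf{Mod}\,R$ is the category of right $R$-modules. Rings and algebras are associative and unital, not necessarily commutative unless stated. An additive category is cocomplete if it has arbitrary direct sums. An additive category is $k$-linear if all its Hom-sets are $k$-modules and composition is $k$-bilinear. For $a\in k$ and an object $X$, write $a_X:=a\cdot\mathrm{id}_X$. On $\mathsf{Mod}\,R$ the $k$-linear structure is $a_M(m)=m\cdot\gamma(a)$, where $\gamma:k\to R$ is the structure map. A functor $F$ between $k$-linear categories is $k$-linear if the maps $\mathrm{Hom}(X,Y)\to \mathrm{Hom}(FX,FY)$ are $k$-linear for all $X,Y$. $\mathsf{B}_k(\mathsf{C},\mathsf{A})$ is the full subcategory of the category of functors $\mathsf{C}\to\mathsf{A}$ consisting of the $k$-linear right exact functors that commute with direct limits. $\mathsf{A}_R$ is the category of left $R$-modules in $\mathsf{A}$: its objects are pairs $(\mathcal{F},\rho)$ with $\mathcal{F}$ an object of $\mathsf{A}$ and $\rho:R\to\mathrm{End}_{\mathsf{A}}(\mathcal{F})$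 a $k$-algebra homomorphism. A morphism $(\mathcal{F},\rho)\to(\mathcal{G},\rho')$ is an $\alpha\in\mathrm{Hom}_{\mathsf{A}}(\mathcal{F},\mathcal{G})$ with $\rho'(r)\circ\alpha=\alpha\circ\rho(r)$ for all $r\in R$. For $(\mathcal{F},\rho)\in\mathsf{A}_R$ and $\mathcal{N}\in\mathsf{A}$, $\mathrm{Hom}_{\mathsf{A}}(\mathcal{F},\mathcal{N})$ is a right $R$-module via $\alpha\cdot r:=\alpha\circ\rho(r)$, giving a functor $\mathrm{Hom}_{\mathsf{A}}(\mathcal{F},-):\mathsf{A}\to\mathsf{Mod}\,R$. This functor has a left adjoint (a known fact, due to cocompleteness); a left adjoint is fixed and denoted $-\otimes_R\mathcal{F}:\mathsf{Mod}\,R\to\mathsf{A}$. *)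

theory Defs
  imports "HOL-Algebra.Module"
begin

section \<open>Small sets\<close>

text \<open>
  Ring and module carriers, Hom-sets and index sets all live in one type \<open>'u\<close>; the family \<open>U\<close>
  singles out the small ones.  The conditions on \<open>U\<close> are closure properties that the sets
  equipotent to members of a Grothendieck universe have; closure under power sets is not required.
\<close>

definition small_universe :: "'u set set \<Rightarrow> bool" where
  "small_universe U \<longleftrightarrow>
     (\<exists>S\<in>U. infinite S) \<and>
     (\<forall>S\<in>U. \<forall>T. T \<subseteq> S \<longrightarrow> T \<in> U) \<and>
     (\<forall>S\<in>U. \<forall>f. f ` S \<in> U) \<and>
     (\<forall>S\<in>U. \<forall>T. (\<forall>s\<in>S. T s \<in> U) \<longrightarrow> (\<Union>s\<in>S. T s) \<in> U)"


section \<open>Categories whose Hom-sets are modules\<close>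

text \<open>
  \<open>Comp C X Y Z g f\<close> is the composite of \<open>f\<close> from \<open>X\<close> to \<open>Y\<close> with \<open>g\<close> from \<open>Y\<close> to \<open>Z\<close>.
  Hom-sets of different pairs of objects need not be disjoint, so composition and the arrow
  part of a functor take the objects as arguments.  The multiplicative part of the record
  \<open>Hom C X Y\<close> carries no meaning.
\<close>

record ('k, 'o, 'a) cat =
  Obj :: "'o set"
  Hom :: "'o \<Rightarrow> 'o \<Rightarrow> ('k, 'a) module"
  Idt :: "'o \<Rightarrow> 'a"
  Comp :: "'o \<Rightarrow> 'o \<Rightarrow> 'o \<Rightarrow> 'a \<Rightarrow> 'a \<Rightarrow> 'a"

abbreviation arr :: "('k, 'o, 'a) cat \<Rightarrow> 'o \<Rightarrow> 'o \<Rightarrow> 'a set" where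
  "arr C X Y \<equiv> carrier (Hom C X Y)"

locale category =
  fixes C :: "('k, 'o, 'a) cat"
  assumes Idt_closed: "X \<in> Obj C \<Longrightarrow> Idt C X \<in> arr C X X"
    and Comp_closed:
      "\<lbrakk> X \<in> Obj C; Y \<in> Obj C; Z \<in> Obj C; f \<in> arr C X Y; g \<in> arr C Y Z \<rbrakk>
       \<Longrightarrow> Comp C X Y Z g f \<in> arr C X Z"
    and Comp_Idt:
      "\<lbrakk> X \<in> Obj C; Y \<in> Obj C; f \<in> arr C X Y \<rbrakk> \<Longrightarrow> Comp C X X Y f (Idt C X) = f"
    and Idt_Comp:
      "\<lbrakk> X \<in> Obj C; Y \<in> Obj C; f \<in> arr C X Y \<rbrakk> \<Longrightarrow> Comp C X Y Y (Idt C Y) f = f"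
    and Comp_assoc:
      "\<lbrakk> W \<in> Obj C; X \<in> Obj C; Y \<in> Obj C; Z \<in> Obj C;
         f \<in> arr C W X; g \<in> arr C X Y; h \<in> arr C Y Z \<rbrakk>
       \<Longrightarrow> Comp C W Y Z h (Comp C W X Y g f) = Comp C W X Z (Comp C X Y Z h g) f"

locale preadditive_category = category +
  assumes Hom_group: "\<lbrakk> X \<in> Obj C; Y \<in> Obj C \<rbrakk> \<Longrightarrow> abelian_group (Hom C X Y)"
    and Comp_add_right:
      "\<lbrakk> X \<in> Obj C; Y \<in> Obj C; Z \<in> Obj C;
         f \<in> arr C X Y; f' \<in> arr C X Y; g \<in> arr C Y Z \<rbrakk>
       \<Longrightarrow> Comp C X Y Z g (f \<oplus>\<^bsub>Hom C X Y\<^esub> f') =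
           Comp C X Y Z g f \<oplus>\<^bsub>Hom C X Z\<^esub> Comp C X Y Z g f'"
    and Comp_add_left:
      "\<lbrakk> X \<in> Obj C; Y \<in> Obj C; Z \<in> Obj C;
         f \<in> arr C X Y; g \<in> arr C Y Z; g' \<in> arr C Y Z \<rbrakk>
       \<Longrightarrow> Comp C X Y Z (g \<oplus>\<^bsub>Hom C Y Z\<^esub> g') f =
           Comp C X Y Z g f \<oplus>\<^bsub>Hom C X Z\<^esub> Comp C X Y Z g' f"

definition zero_object :: "('k, 'o, 'a) cat \<Rightarrow> 'o \<Rightarrow> bool" where
  "zero_object C Z \<longleftrightarrow> Z \<in> Obj C \<and>
     (\<forall>X\<in>Obj C. (\<exists>!f. f \<in> arr C X Z) \<and> (\<exists>!f. f \<in> arr C Z X))"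

definition biproduct ::
  "('k, 'o, 'a) cat \<Rightarrow> 'o \<Rightarrow> 'o \<Rightarrow> 'o \<Rightarrow> 'a \<Rightarrow> 'a \<Rightarrow> 'a \<Rightarrow> 'a \<Rightarrow> bool" where
  "biproduct C X Y S i j p q \<longleftrightarrow> S \<in> Obj C \<and>
     i \<in> arr C X S \<and> j \<in> arr C Y S \<and> p \<in> arr C S X \<and> q \<in> arr C S Y \<and>
     Comp C X S X p i = Idt C X \<and> Comp C Y S Y q j = Idt C Y \<and>
     Comp C X S Y q i = \<zero>\<^bsub>Hom C X Y\<^esub> \<and> Comp C Y S X p j = \<zero>\<^bsub>Hom C Y X\<^esub> \<and>
     Comp C S X S i p \<oplus>\<^bsub>Hom C S S\<^esub> Comp C S Y S j q = Idt C S"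

locale additive_category = preadditive_category +
  assumes ex_zero_object: "\<exists>Z. zero_object C Z"
    and ex_biproduct:
      "\<lbrakk> X \<in> Obj C; Y \<in> Obj C \<rbrakk> \<Longrightarrow> \<exists>S i j p q. biproduct C X Y S i j p q"

definition monic :: "('k, 'o, 'a) cat \<Rightarrow> 'o \<Rightarrow> 'o \<Rightarrow> 'a \<Rightarrow> bool" where
  "monic C X Y f \<longleftrightarrow> f \<in> arr C X Y \<and>
     (\<forall>W\<in>Obj C. \<forall>g\<in>arr C W X. \<forall>h\<in>arr C W X.
        Comp C W X Y f g = Comp C W X Y f h \<longrightarrow> g = h)"

definition epic :: "('k, 'o, 'a) cat \<Rightarrow> 'o \<Rightarrow> 'o \<Rightarrow> 'a \<Rightarrow> bool" where
  "epic C X Y f \<longleftrightarrow> f \<in> arr C X Y \<and>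
     (\<forall>Z\<in>Obj C. \<forall>g\<in>arr C Y Z. \<forall>h\<in>arr C Y Z.
        Comp C X Y Z g f = Comp C X Y Z h f \<longrightarrow> g = h)"

definition isomorphism :: "('k, 'o, 'a) cat \<Rightarrow> 'o \<Rightarrow> 'o \<Rightarrow> 'a \<Rightarrow> bool" where
  "isomorphism C X Y f \<longleftrightarrow> f \<in> arr C X Y \<and>
     (\<exists>g\<in>arr C Y X. Comp C X Y X g f = Idt C X \<and> Comp C Y X Y f g = Idt C Y)"

definition is_kernel :: "('k, 'o, 'a) cat \<Rightarrow> 'o \<Rightarrow> 'o \<Rightarrow> 'a \<Rightarrow> 'o \<Rightarrow> 'a \<Rightarrow> bool" where
  "is_kernel C X Y f K i \<longleftrightarrow>
     K \<in> Obj C \<and> i \<in> arr C K X \<and> Comp C K X Y f i = \<zero>\<^bsub>Hom C K Y\<^esub> \<and>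
     (\<forall>W\<in>Obj C. \<forall>g\<in>arr C W X. Comp C W X Y f g = \<zero>\<^bsub>Hom C W Y\<^esub> \<longrightarrow>
        (\<exists>!h. h \<in> arr C W K \<and> Comp C W K X i h = g))"

definition is_cokernel :: "('k, 'o, 'a) cat \<Rightarrow> 'o \<Rightarrow> 'o \<Rightarrow> 'a \<Rightarrow> 'o \<Rightarrow> 'a \<Rightarrow> bool" where
  "is_cokernel C X Y f Q q \<longleftrightarrow>
     Q \<in> Obj C \<and> q \<in> arr C Y Q \<and> Comp C X Y Q q f = \<zero>\<^bsub>Hom C X Q\<^esub> \<and>
     (\<forall>Z\<in>Obj C. \<forall>g\<in>arr C Y Z. Comp C X Y Z g f = \<zero>\<^bsub>Hom C X Z\<^esub> \<longrightarrow>
        (\<exists>!h. h \<in> arr C Q Z \<and> Comp C Y Q Z h q = g))"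

locale abelian_category = additive_category +
  assumes ex_kernel:
      "\<lbrakk> X \<in> Obj C; Y \<in> Obj C; f \<in> arr C X Y \<rbrakk> \<Longrightarrow> \<exists>K i. is_kernel C X Y f K i"
    and ex_cokernel:
      "\<lbrakk> X \<in> Obj C; Y \<in> Obj C; f \<in> arr C X Y \<rbrakk> \<Longrightarrow> \<exists>Q q. is_cokernel C X Y f Q q"
    and monic_is_kernel:
      "\<lbrakk> X \<in> Obj C; Y \<in> Obj C; monic C X Y f \<rbrakk>
       \<Longrightarrow> \<exists>Z\<in>Obj C. \<exists>g\<in>arr C Y Z. is_kernel C Y Z g X f"
    and epic_is_cokernel:
      "\<lbrakk> X \<in> Obj C; Y \<in> Obj C; epic C X Y f \<rbrakk>
       \<Longrightarrow> \<exists>W\<in>Obj C. \<exists>g\<in>arr C W X. is_cokernel C W X g Y f"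

locale linear_category = preadditive_category C + cring k
  for k :: "('k, 'z) ring_scheme" and C :: "('k, 'o, 'a) cat" +
  assumes Hom_module: "\<lbrakk> X \<in> Obj C; Y \<in> Obj C \<rbrakk> \<Longrightarrow> module k (Hom C X Y)"
    and Comp_smult_right:
      "\<lbrakk> a \<in> carrier k; X \<in> Obj C; Y \<in> Obj C; Z \<in> Obj C; f \<in> arr C X Y; g \<in> arr C Y Z \<rbrakk>
       \<Longrightarrow> Comp C X Y Z g (a \<odot>\<^bsub>Hom C X Y\<^esub> f) = a \<odot>\<^bsub>Hom C X Z\<^esub> Comp C X Y Z g f"
    and Comp_smult_left:
      "\<lbrakk> a \<in> carrier k; X \<in> Obj C; Y \<in> Obj C; Z \<in> Obj C; f \<in> arr C X Y; g \<in> arr C Y Z \<rbrakk>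
       \<Longrightarrow> Comp C X Y Z (a \<odot>\<^bsub>Hom C Y Z\<^esub> g) f = a \<odot>\<^bsub>Hom C X Z\<^esub> Comp C X Y Z g f"

definition is_coproduct ::
  "('k, 'o, 'a) cat \<Rightarrow> 'i set \<Rightarrow> ('i \<Rightarrow> 'o) \<Rightarrow> 'o \<Rightarrow> ('i \<Rightarrow> 'a) \<Rightarrow> bool" where
  "is_coproduct C I X S \<iota> \<longleftrightarrow>
     S \<in> Obj C \<and> (\<forall>i\<in>I. \<iota> i \<in> arr C (X i) S) \<and>
     (\<forall>Z\<in>Obj C. \<forall>g. (\<forall>i\<in>I. g i \<in> arr C (X i) Z) \<longrightarrow>
        (\<exists>!h. h \<in> arr C S Z \<and> (\<forall>i\<in>I. Comp C (X i) S Z h (\<iota> i) = g i)))"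

definition cocomplete :: "'u set set \<Rightarrow> ('k, 'o, 'a) cat \<Rightarrow> bool" where
  "cocomplete U C \<longleftrightarrow>
     (\<forall>I\<in>U. \<forall>X. (\<forall>i\<in>I. X i \<in> Obj C) \<longrightarrow> (\<exists>S \<iota>. is_coproduct C I X S \<iota>))"

text \<open>Exactness at \<open>Y\<close>: the image of \<open>f\<close>, i.e. the kernel of its cokernel, is the kernel of \<open>g\<close>.\<close>

definition exact_at ::
  "('k, 'o, 'a) cat \<Rightarrow> 'o \<Rightarrow> 'o \<Rightarrow> 'o \<Rightarrow> 'a \<Rightarrow> 'a \<Rightarrow> bool" where
  "exact_at C X Y Z f g \<longleftrightarrow> f \<in> arr C X Y \<and> g \<in> arr C Y Z \<and>
     (\<exists>Q q I i. is_cokernel C X Y f Q q \<and> is_kernel C Y Q q I i \<and> is_kernel C Y Z g I i)"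

definition directed_system ::
  "('k, 'o, 'a) cat \<Rightarrow> 'i set \<Rightarrow> ('i \<times> 'i) set \<Rightarrow> ('i \<Rightarrow> 'o) \<Rightarrow> ('i \<Rightarrow> 'i \<Rightarrow> 'a) \<Rightarrow> bool" where
  "directed_system C I r X t \<longleftrightarrow>
     I \<noteq> {} \<and> partial_order_on I r \<and>
     (\<forall>i\<in>I. \<forall>j\<in>I. \<exists>l\<in>I. (i, l) \<in> r \<and> (j, l) \<in> r) \<and>
     (\<forall>i\<in>I. X i \<in> Obj C) \<and>
     (\<forall>(i, j)\<in>r. t i j \<in> arr C (X i) (X j)) \<and>
     (\<forall>i\<in>I. t i i = Idt C (X i)) \<and>
     (\<forall>i j l. (i, j) \<in> r \<and> (j, l) \<in> r \<longrightarrow>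
        Comp C (X i) (X j) (X l) (t j l) (t i j) = t i l)"

definition is_cocone ::
  "('k, 'o, 'a) cat \<Rightarrow> 'i set \<Rightarrow> ('i \<times> 'i) set \<Rightarrow> ('i \<Rightarrow> 'o) \<Rightarrow> ('i \<Rightarrow> 'i \<Rightarrow> 'a) \<Rightarrow>
   'o \<Rightarrow> ('i \<Rightarrow> 'a) \<Rightarrow> bool" where
  "is_cocone C I r X t L c \<longleftrightarrow>
     L \<in> Obj C \<and> (\<forall>i\<in>I. c i \<in> arr C (X i) L) \<and>
     (\<forall>(i, j)\<in>r. Comp C (X i) (X j) L (c j) (t i j) = c i)"

definition is_direct_limit ::
  "('k, 'o, 'a) cat \<Rightarrow> 'i set \<Rightarrow> ('i \<times> 'i) set \<Rightarrow> ('i \<Rightarrow> 'o) \<Rightarrow> ('i \<Rightarrow> 'i \<Rightarrow> 'a) \<Rightarrow>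
   'o \<Rightarrow> ('i \<Rightarrow> 'a) \<Rightarrow> bool" where
  "is_direct_limit C I r X t L c \<longleftrightarrow>
     is_cocone C I r X t L c \<and>
     (\<forall>Z d. is_cocone C I r X t Z d \<longrightarrow>
        (\<exists>!h. h \<in> arr C L Z \<and> (\<forall>i\<in>I. Comp C (X i) L Z h (c i) = d i)))"


section \<open>Functors\<close>

record ('o, 'a, 'p, 'b) func =
  FObj :: "'o \<Rightarrow> 'p"
  FMap :: "'o \<Rightarrow> 'o \<Rightarrow> 'a \<Rightarrow> 'b"

definition is_functor ::
  "('k, 'o, 'a) cat \<Rightarrow> ('l, 'p, 'b) cat \<Rightarrow> ('o, 'a, 'p, 'b) func \<Rightarrow> bool" where
  "is_functor C D F \<longleftrightarrow>
     (\<forall>X\<in>Obj C. FObj F X \<in> Obj D) \<and>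
     (\<forall>X\<in>Obj C. \<forall>Y\<in>Obj C. \<forall>f\<in>arr C X Y. FMap F X Y f \<in> arr D (FObj F X) (FObj F Y)) \<and>
     (\<forall>X\<in>Obj C. FMap F X X (Idt C X) = Idt D (FObj F X)) \<and>
     (\<forall>X\<in>Obj C. \<forall>Y\<in>Obj C. \<forall>Z\<in>Obj C. \<forall>f\<in>arr C X Y. \<forall>g\<in>arr C Y Z.
        FMap F X Z (Comp C X Y Z g f) =
        Comp D (FObj F X) (FObj F Y) (FObj F Z) (FMap F Y Z g) (FMap F X Y f))"

definition linear_functor ::
  "('k, 'z) ring_scheme \<Rightarrow> ('k, 'o, 'a) cat \<Rightarrow> ('k, 'p, 'b) cat \<Rightarrow>
   ('o, 'a, 'p, 'b) func \<Rightarrow> bool" where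
  "linear_functor k C D F \<longleftrightarrow> is_functor C D F \<and>
     (\<forall>X\<in>Obj C. \<forall>Y\<in>Obj C. \<forall>f\<in>arr C X Y. \<forall>g\<in>arr C X Y.
        FMap F X Y (f \<oplus>\<^bsub>Hom C X Y\<^esub> g) =
        FMap F X Y f \<oplus>\<^bsub>Hom D (FObj F X) (FObj F Y)\<^esub> FMap F X Y g) \<and>
     (\<forall>a\<in>carrier k. \<forall>X\<in>Obj C. \<forall>Y\<in>Obj C. \<forall>f\<in>arr C X Y.
        FMap F X Y (a \<odot>\<^bsub>Hom C X Y\<^esub> f) =
        a \<odot>\<^bsub>Hom D (FObj F X) (FObj F Y)\<^esub> FMap F X Y f)"

text \<open>Exact sequences \<open>X \<rightarrow> Y \<rightarrow> Z \<rightarrow> 0\<close> are sent to exact sequences.\<close>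

definition right_exact ::
  "('k, 'o, 'a) cat \<Rightarrow> ('l, 'p, 'b) cat \<Rightarrow> ('o, 'a, 'p, 'b) func \<Rightarrow> bool" where
  "right_exact C D F \<longleftrightarrow>
     (\<forall>X\<in>Obj C. \<forall>Y\<in>Obj C. \<forall>Z\<in>Obj C. \<forall>f g.
        exact_at C X Y Z f g \<and> epic C Y Z g \<longrightarrow>
        exact_at D (FObj F X) (FObj F Y) (FObj F Z) (FMap F X Y f) (FMap F Y Z g) \<and>
        epic D (FObj F Y) (FObj F Z) (FMap F Y Z g))"

definition preserves_direct_limits ::
  "'u set set \<Rightarrow> ('k, 'o, 'a) cat \<Rightarrow> ('l, 'p, 'b) cat \<Rightarrow> ('o, 'a, 'p, 'b) func \<Rightarrow> bool" where
  "preserves_direct_limits U C D F \<longleftrightarrow>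
     (\<forall>I\<in>U. \<forall>r X t L c.
        directed_system C I r X t \<and> is_direct_limit C I r X t L c \<longrightarrow>
        is_direct_limit D I r (\<lambda>i. FObj F (X i)) (\<lambda>i j. FMap F (X i) (X j) (t i j))
          (FObj F L) (\<lambda>i. FMap F (X i) L (c i)))"

definition Bk ::
  "('k, 'z) ring_scheme \<Rightarrow> 'u set set \<Rightarrow> ('k, 'o, 'a) cat \<Rightarrow> ('k, 'p, 'b) cat \<Rightarrow>
   ('o, 'a, 'p, 'b) func set" where
  "Bk k U C A =
     {F. linear_functor k C A F \<and> right_exact C A F \<and> preserves_direct_limits U C A F}"

definition natural_iso ::
  "('k, 'o, 'a) cat \<Rightarrow> ('l, 'p, 'b) cat \<Rightarrow> ('o, 'a, 'p, 'b) func \<Rightarrow> ('o, 'a, 'p, 'b) func \<Rightarrow>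
   ('o \<Rightarrow> 'b) \<Rightarrow> bool" where
  "natural_iso C D F G \<eta> \<longleftrightarrow>
     (\<forall>X\<in>Obj C. isomorphism D (FObj F X) (FObj G X) (\<eta> X)) \<and>
     (\<forall>X\<in>Obj C. \<forall>Y\<in>Obj C. \<forall>f\<in>arr C X Y.
        Comp D (FObj F X) (FObj F Y) (FObj G Y) (\<eta> Y) (FMap F X Y f) =
        Comp D (FObj F X) (FObj G X) (FObj G Y) (FMap G X Y f) (\<eta> X))"

text \<open>
  Here \<open>C\<close> is meant to be a full subcategory of \<open>D\<close>, and \<open>L : C \<rightarrow> A\<close> is left adjoint to
  \<open>G : A \<rightarrow> D\<close> relative to the inclusion: there are bijections
  \<open>Hom\<^sub>A (L X, N) \<cong> Hom\<^sub>D (X, G N)\<close>, natural in \<open>X\<close> in \<open>C\<close> and \<open>N\<close> in \<open>A\<close>.  If \<open>G\<close> takes values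
  in \<open>C\<close>, this is an ordinary adjunction between \<open>C\<close> and \<open>A\<close>.
\<close>

definition is_left_adjoint ::
  "('k, 'o, 'a) cat \<Rightarrow> ('k, 'o, 'a) cat \<Rightarrow> ('l, 'p, 'b) cat \<Rightarrow>
   ('o, 'a, 'p, 'b) func \<Rightarrow> ('p, 'b, 'o, 'a) func \<Rightarrow> bool" where
  "is_left_adjoint C D A L G \<longleftrightarrow>
     is_functor C A L \<and> is_functor A D G \<and>
     (\<exists>\<phi>.
        (\<forall>X\<in>Obj C. \<forall>N\<in>Obj A. bij_betw (\<phi> X N) (arr A (FObj L X) N) (arr D X (FObj G N))) \<and>
        (\<forall>X\<in>Obj C. \<forall>X'\<in>Obj C. \<forall>N\<in>Obj A. \<forall>u\<in>arr C X' X. \<forall>g\<in>arr A (FObj L X) N.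
           \<phi> X' N (Comp A (FObj L X') (FObj L X) N g (FMap L X' X u)) =
           Comp D X' X (FObj G N) (\<phi> X N g) u) \<and>
        (\<forall>X\<in>Obj C. \<forall>N\<in>Obj A. \<forall>N'\<in>Obj A. \<forall>h\<in>arr A N N'. \<forall>g\<in>arr A (FObj L X) N.
           \<phi> X N' (Comp A (FObj L X) N N' h g) =
           Comp D X (FObj G N) (FObj G N') (FMap G N N' h) (\<phi> X N g)))"


section \<open>Algebras and right modules\<close>

text \<open>\<open>R\<close> need not be commutative; the structure map \<open>\<gamma>\<close> lands in its centre.\<close>

definition k_algebra ::
  "('k, 'z) ring_scheme \<Rightarrow> ('u, 'y) ring_scheme \<Rightarrow> ('k \<Rightarrow> 'u) \<Rightarrow> bool" where
  "k_algebra k R \<gamma> \<longleftrightarrow> cring k \<and> ring R \<and> \<gamma> \<in> ring_hom k R \<and>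
     (\<forall>a\<in>carrier k. \<forall>x\<in>carrier R. \<gamma> a \<otimes>\<^bsub>R\<^esub> x = x \<otimes>\<^bsub>R\<^esub> \<gamma> a)"

text \<open>
  In a right module \<open>r \<odot>\<^bsub>M\<^esub> m\<close> stands for \<open>m \<cdot> r\<close>; hence the order of the factors in
  \<open>act_assoc\<close>.
\<close>

locale right_module = R: ring R + M: abelian_group M
  for R :: "('r, 'y) ring_scheme" and M :: "('r, 'm) module" +
  assumes act_closed: "\<lbrakk> r \<in> carrier R; m \<in> carrier M \<rbrakk> \<Longrightarrow> r \<odot>\<^bsub>M\<^esub> m \<in> carrier M"
    and act_add_ring:
      "\<lbrakk> r \<in> carrier R; s \<in> carrier R; m \<in> carrier M \<rbrakk>
       \<Longrightarrow> (r \<oplus>\<^bsub>R\<^esub> s) \<odot>\<^bsub>M\<^esub> m = r \<odot>\<^bsub>M\<^esub> m \<oplus>\<^bsub>M\<^esub> s \<odot>\<^bsub>M\<^esub> m"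
    and act_add_mod:
      "\<lbrakk> r \<in> carrier R; m \<in> carrier M; n \<in> carrier M \<rbrakk>
       \<Longrightarrow> r \<odot>\<^bsub>M\<^esub> (m \<oplus>\<^bsub>M\<^esub> n) = r \<odot>\<^bsub>M\<^esub> m \<oplus>\<^bsub>M\<^esub> r \<odot>\<^bsub>M\<^esub> n"
    and act_assoc:
      "\<lbrakk> r \<in> carrier R; s \<in> carrier R; m \<in> carrier M \<rbrakk>
       \<Longrightarrow> s \<odot>\<^bsub>M\<^esub> (r \<odot>\<^bsub>M\<^esub> m) = (r \<otimes>\<^bsub>R\<^esub> s) \<odot>\<^bsub>M\<^esub> m"
    and act_one: "m \<in> carrier M \<Longrightarrow> \<one>\<^bsub>R\<^esub> \<odot>\<^bsub>M\<^esub> m = m"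

text \<open>Homomorphisms are extensional functions, so that equality of morphisms is equality on the carrier.\<close>

definition rmod_hom ::
  "('r, 'y) ring_scheme \<Rightarrow> ('r, 'm) module \<Rightarrow> ('r, 'm) module \<Rightarrow> ('m \<Rightarrow> 'm) set" where
  "rmod_hom R M N = {f \<in> carrier M \<rightarrow>\<^sub>E carrier N.
     (\<forall>m\<in>carrier M. \<forall>n\<in>carrier M. f (m \<oplus>\<^bsub>M\<^esub> n) = f m \<oplus>\<^bsub>N\<^esub> f n) \<and>
     (\<forall>r\<in>carrier R. \<forall>m\<in>carrier M. f (r \<odot>\<^bsub>M\<^esub> m) = r \<odot>\<^bsub>N\<^esub> f m)}"

text \<open>The \<open>k\<close>-linear category of right \<open>R\<close>-modules whose carrier belongs to \<open>U\<close>.\<close>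

definition Mod ::
  "('r, 'y) ring_scheme \<Rightarrow> ('k \<Rightarrow> 'r) \<Rightarrow> 'm set set \<Rightarrow> ('k, ('r, 'm) module, 'm \<Rightarrow> 'm) cat" where
  "Mod R \<gamma> U = \<lparr>
     Obj = {M. right_module R M \<and> carrier M \<in> U},
     Hom = (\<lambda>M N. \<lparr>
       carrier = rmod_hom R M N, mult = undefined, one = undefined,
       zero = (\<lambda>m\<in>carrier M. \<zero>\<^bsub>N\<^esub>),
       add = (\<lambda>f g. \<lambda>m\<in>carrier M. f m \<oplus>\<^bsub>N\<^esub> g m),
       smult = (\<lambda>a f. \<lambda>m\<in>carrier M. \<gamma> a \<odot>\<^bsub>N\<^esub> f m) \<rparr>),
     Idt = (\<lambda>M. \<lambda>m\<in>carrier M. m),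
     Comp = (\<lambda>M N P g f. compose (carrier M) g f) \<rparr>"

definition regular_module :: "('u, 'y) ring_scheme \<Rightarrow> ('u, 'u) module" where
  "regular_module R = \<lparr>
     carrier = carrier R, mult = mult R, one = one R, zero = zero R, add = add R,
     smult = (\<lambda>r m. m \<otimes>\<^bsub>R\<^esub> r) \<rparr>"

definition left_mult :: "('u, 'y) ring_scheme \<Rightarrow> 'u \<Rightarrow> 'u \<Rightarrow> 'u" where
  "left_mult R x = (\<lambda>r\<in>carrier R. x \<otimes>\<^bsub>R\<^esub> r)"


section \<open>Left modules in a linear category and the tensor product\<close>

definition End_ring :: "('k, 'o, 'a) cat \<Rightarrow> 'o \<Rightarrow> 'a ring" where
  "End_ring A X = \<lparr>
     carrier = arr A X X, mult = Comp A X X X, one = Idt A X,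
     zero = \<zero>\<^bsub>Hom A X X\<^esub>, add = add (Hom A X X) \<rparr>"

text \<open>The objects of the category of left \<open>R\<close>-modules in \<open>A\<close>.\<close>

definition left_modules_in ::
  "('k, 'z) ring_scheme \<Rightarrow> ('u, 'y) ring_scheme \<Rightarrow> ('k \<Rightarrow> 'u) \<Rightarrow> ('k, 'o, 'a) cat \<Rightarrow>
   ('o \<times> ('u \<Rightarrow> 'a)) set" where
  "left_modules_in k R \<gamma> A =
     {(X, \<rho>). X \<in> Obj A \<and> \<rho> \<in> ring_hom R (End_ring A X) \<and>
        (\<forall>a\<in>carrier k. \<rho> (\<gamma> a) = a \<odot>\<^bsub>Hom A X X\<^esub> Idt A X)}"

text \<open>\<open>Hom\<^sub>A (X, -)\<close> with the right action \<open>\<alpha> \<cdot> r = \<alpha> \<circ> \<rho> r\<close>.\<close>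

definition Hom_functor ::
  "('k, 'o, 'u) cat \<Rightarrow> 'o \<times> ('r \<Rightarrow> 'u) \<Rightarrow> ('o, 'u, ('r, 'u) module, 'u \<Rightarrow> 'u) func" where
  "Hom_functor A = (\<lambda>(X, \<rho>). \<lparr>
     FObj = (\<lambda>N. \<lparr>
       carrier = arr A X N, mult = undefined, one = undefined,
       zero = \<zero>\<^bsub>Hom A X N\<^esub>, add = add (Hom A X N),
       smult = (\<lambda>r \<alpha>. Comp A X X N \<alpha> (\<rho> r)) \<rparr>),
     FMap = (\<lambda>N N' \<beta>. \<lambda>\<alpha>\<in>arr A X N. Comp A X N N' \<beta> \<alpha>) \<rparr>)"

text \<open>
  \<open>T\<close> is a choice of \<open>- \<otimes>\<^sub>R X\<close> on small modules.  The module \<open>Hom\<^sub>A (X, N)\<close> is allowed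
  to be large, hence \<open>UNIV\<close>; if \<open>A\<close> has small Hom-sets then \<open>Hom\<^sub>A (X, -)\<close> takes values in
  \<open>Mod R \<gamma> U\<close> and \<open>T\<close> is a left adjoint of it in the usual sense.  Smallness of the Hom-sets
  is not imposed, because together with small coproducts it is very restrictive unless \<open>'u\<close>
  has (strong limit) large cardinality.
\<close>

definition is_tensor_functor ::
  "('u, 'y) ring_scheme \<Rightarrow> ('k \<Rightarrow> 'u) \<Rightarrow> 'u set set \<Rightarrow> ('k, 'o, 'u) cat \<Rightarrow> 'o \<times> ('u \<Rightarrow> 'u) \<Rightarrow>
   (('u, 'u) module, 'u \<Rightarrow> 'u, 'o, 'u) func \<Rightarrow> bool" where
  "is_tensor_functor R \<gamma> U A X T \<longleftrightarrow>
     is_left_adjoint (Mod R \<gamma> U) (Mod R \<gamma> UNIV) A T (Hom_functor A X)"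

end

theory Submission
  imports Defs
begin

text \<open>
  The idea is to show that \<open>F\<close> itself is left adjoint to \<open>Hom\<^sub>A (FR, -)\<close>; uniqueness of left
  adjoints (\<open>left_adjoint_unique\<close>) then gives \<open>F \<cong> - \<otimes>\<^sub>R FR\<close>.

  An element \<open>m\<close> of a module \<open>M\<close> is the same as the homomorphism \<open>R \<rightarrow> M\<close>, \<open>r \<mapsto> m \<cdot> r\<close>, and \<open>F\<close> turns
  it into an arrow \<open>FR \<rightarrow> FM\<close>, the \<^emph>\<open>orbit arrow\<close> of \<open>m\<close>.  Precomposition with the orbit arrows
  sends \<open>b : FM \<rightarrow> N\<close> to a homomorphism \<open>M \<rightarrow> Hom\<^sub>A (FR, N)\<close>, the \<^emph>\<open>transpose\<close> of \<open>b\<close>.  It is natural in \<open>M\<close>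
  and \<open>N\<close>, so everything comes down to its being bijective for every \<open>M\<close>.  Call \<open>M\<close> \<^emph>\<open>determined\<close> if transposition is
  injective for all \<open>N\<close>, and \<^emph>\<open>representable\<close> if it is bijective for all \<open>N\<close>.

  Both properties are obtained from an induction principle (\<open>module_induct\<close>): a property of small modules
  that holds for \<open>R\<close> and is inherited by binary direct sums, by surjective images and by direct limits
  holds for all of them, since finitely generated modules arise from \<open>R\<close> by sums and images, and
  every module is the direct limit of its finitely generated submodules.  Using finitely generated
  submodules avoids free modules on infinite sets; only finite subsets and pairs have to be coded as
  elements of the carrier type.

  For \<open>R\<close> the claim is the identity \<open>b = b \<circ> F 1\<close>; sums are handled by additivity of \<open>F\<close>, direct limits by
  the hypothesis on \<open>F\<close>.  For a surjection \<open>P \<rightarrow> M\<close> with kernel \<open>K\<close>, right exactness makes \<open>FP \<rightarrow> FM\<close> epic, which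
  suffices for injectivity, and makes \<open>FM\<close> the cokernel of \<open>FK \<rightarrow> FP\<close>.  To construct an arrow out of \<open>FM\<close>
  one has to see that an arrow \<open>FP \<rightarrow> N\<close> vanishes on \<open>FK\<close>.  Its composites with the orbit arrows of \<open>K\<close> vanish,
  so this follows once \<open>K\<close> is known to be determined.  As \<open>K\<close> need not be finitely generated, the
  induction is run twice: \<open>all_determined\<close> comes first, and \<open>all_representable\<close> uses it.
\<close>


section \<open>Small sets\<close>

lemma small_subset: "\<lbrakk> small_universe U; S \<in> U; T \<subseteq> S \<rbrakk> \<Longrightarrow> T \<in> U"
  unfolding small_universe_def by blast

lemma small_image: "\<lbrakk> small_universe U; S \<in> U \<rbrakk> \<Longrightarrow> f ` S \<in> U"
  unfolding small_universe_def by blast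

lemma small_UNION: "\<lbrakk> small_universe U; S \<in> U; \<And>s. s \<in> S \<Longrightarrow> T s \<in> U \<rbrakk> \<Longrightarrow> (\<Union>s\<in>S. T s) \<in> U"
  unfolding small_universe_def by blast

lemma small_Un:
  assumes U: "small_universe U" and "S \<in> U" "T \<in> U"
  shows "S \<union> T \<in> U"
proof -
  obtain W where W: "W \<in> U" "infinite W"
    using U unfolding small_universe_def by blast
  obtain a where a: "a \<in> W" using infinite_imp_nonempty[OF W(2)] by blast
  obtain b where b: "b \<in> W" "b \<noteq> a"
    using infinite_imp_nonempty[OF infinite_remove[OF W(2), of a]] by blast
  have "(\<Union>w\<in>W. if w = a then S else T) \<in> U"
    using assms W(1) by (intro small_UNION) auto
  moreover have "(\<Union>w\<in>W. if w = a then S else T) = S \<union> T"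
    using a b by auto
  ultimately show ?thesis by simp
qed

text \<open>Pairs are coded by an arbitrary function \<open>e\<close> because products are not among the closure properties of \<open>U\<close>.\<close>
lemma small_coded_Times:
  fixes e :: "'u \<times> 'u \<Rightarrow> 'u"
  assumes U: "small_universe U" and "S \<in> U" "T \<in> U"
  shows "e ` (S \<times> T) \<in> U"
proof -
  have "(\<Union>s\<in>S. (\<lambda>t. e (s, t)) ` T) \<in> U"
    using assms by (intro small_UNION small_image) auto
  moreover have "(\<Union>s\<in>S. (\<lambda>t. e (s, t)) ` T) = e ` (S \<times> T)" by auto
  ultimately show ?thesis by simp
qed

lemma ex_pair_code:
  assumes "small_universe (U :: 'u set set)"
  shows "\<exists>e :: 'u \<times> 'u \<Rightarrow> 'u. inj e"
proof -
  have "infinite (UNIV :: 'u set)"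
    using assms unfolding small_universe_def by (meson finite_subset subset_UNIV)
  then have "\<exists>f. bij_betw f ((UNIV :: 'u set) \<times> (UNIV :: 'u set)) (UNIV :: 'u set)"
    unfolding card_of_ordIso by (rule card_of_Times_same_infinite)
  then show ?thesis by (auto simp: bij_betw_def)
qed

text \<open>
  The entries of the sequence of length \<open>n\<close> coded by \<open>t\<close>, where \<open>d\<close> splits a code into head and tail.
\<close>
primrec decode_set :: "('u \<Rightarrow> 'u \<times> 'u) \<Rightarrow> nat \<Rightarrow> 'u \<Rightarrow> 'u set" where
  "decode_set d 0 t = {}"
| "decode_set d (Suc n) t = insert (fst (d t)) (decode_set d n (snd (d t)))"

text \<open>
  The sets with \<open>n\<close> elements are parametrized by a small set of \<open>n\<close>-fold nested pairs.  An infinite small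
  set then supplies codes for the numbers \<open>n\<close>, and the union over \<open>n\<close> is again small.  Choosing one
  code for each finite set makes the parametrization bijective.
\<close>
lemma ex_small_index_of_finite_subsets:
  fixes S :: "'u set"
  assumes U: "small_universe U" and S: "S \<in> U"
  shows "\<exists>I\<in>U. \<exists>D. bij_betw D I {A. finite A \<and> A \<subseteq> S}"
proof -
  obtain W where W: "W \<in> U" "infinite W"
    using U unfolding small_universe_def by blast
  obtain f :: "nat \<Rightarrow> 'u" where f: "inj f" "range f \<subseteq> W"
    using infinite_countable_subset[OF W(2)] by blast
  obtain e :: "'u \<times> 'u \<Rightarrow> 'u" where e: "inj e"
    using ex_pair_code[OF U] by (elim exE)
  let ?d = "inv_into UNIV e"
  have level: "\<exists>T\<in>U. \<forall>A. finite A \<and> card A = n \<and> A \<subseteq> S \<longrightarrow> A \<in> decode_set ?d n ` T" for n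
  proof (induction n)
    case 0
    show ?case using W(1) infinite_imp_nonempty[OF W(2)] by (intro bexI[of _ W]) auto
  next
    case (Suc n)
    then obtain T where T: "T \<in> U"
        "\<And>A. \<lbrakk> finite A; card A = n; A \<subseteq> S \<rbrakk> \<Longrightarrow> A \<in> decode_set ?d n ` T"
      by auto
    have "A \<in> decode_set ?d (Suc n) ` (e ` (S \<times> T))" if A: "card A = Suc n" "A \<subseteq> S" for A
    proof -
      obtain a B where B: "A = insert a B" "a \<notin> B" "card B = n" "finite B"
        using A(1) by (auto simp: card_Suc_eq_finite)
      then have "B \<in> decode_set ?d n ` T" using A(2) by (intro T(2)) auto
      then obtain t where t: "t \<in> T" "B = decode_set ?d n t" by (rule imageE)
      have "A = decode_set ?d (Suc n) (e (a, t))" using B(1) t(2) e by simp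
      moreover have "a \<in> S" using A(2) B(1) by simp
      ultimately show ?thesis using t(1) by (intro image_eqI[of _ _ "e (a, t)"]) auto
    qed
    then show ?case using small_coded_Times[OF U S T(1)] by (intro bexI[of _ "e ` (S \<times> T)"]) auto
  qed
  then obtain T where T: "\<And>n. T n \<in> U"
      "\<And>n A. \<lbrakk> finite A; card A = n; A \<subseteq> S \<rbrakk> \<Longrightarrow> A \<in> decode_set ?d n ` T n"
    by metis
  \<comment> \<open>a code for a finite set \<open>A\<close> is a pair of a code for \<open>card A\<close> and a code for the elements of \<open>A\<close>\<close>
  define V where "V = (\<Union>w\<in>W. (\<lambda>t. e (w, t)) ` T (inv_into UNIV f w))"
  define D where "D v = decode_set ?d (inv_into UNIV f (fst (?d v))) (snd (?d v))" for v
  have V: "V \<in> U" unfolding V_def by (intro small_UNION[OF U W(1)] small_image[OF U] T(1))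
  have onto: "A \<in> D ` V" if A: "finite A" "A \<subseteq> S" for A
  proof -
    obtain t where t: "t \<in> T (card A)" "A = decode_set ?d (card A) t"
      using T(2)[OF A(1) refl A(2)] by (rule imageE)
    have "A = D (e (f (card A), t))" using t(2) e f(1) by (simp add: D_def)
    moreover have "e (f (card A), t) \<in> V"
      unfolding V_def using f t(1) by (intro UN_I[of "f (card A)"]) auto
    ultimately show ?thesis by (rule image_eqI)
  qed
  let ?F = "{A. finite A \<and> A \<subseteq> S}"
  let ?I = "inv_into V D ` ?F"
  have "?I \<subseteq> V" using onto by (auto intro: inv_into_into)
  then have "?I \<in> U" by (rule small_subset[OF U V])
  moreover have "bij_betw D ?I ?F"
    using onto by (intro bij_betw_imageI inj_onI) (auto simp: f_inv_into_f image_iff)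
  ultimately show ?thesis by (intro bexI exI)
qed


section \<open>Right modules\<close>

context right_module
begin

lemma act_zero:
  assumes r: "r \<in> carrier R" shows "r \<odot>\<^bsub>M\<^esub> \<zero>\<^bsub>M\<^esub> = \<zero>\<^bsub>M\<^esub>"
proof -
  have "r \<odot>\<^bsub>M\<^esub> \<zero>\<^bsub>M\<^esub> = r \<odot>\<^bsub>M\<^esub> \<zero>\<^bsub>M\<^esub> \<oplus>\<^bsub>M\<^esub> r \<odot>\<^bsub>M\<^esub> \<zero>\<^bsub>M\<^esub>"
    using act_add_mod[OF r, of "\<zero>\<^bsub>M\<^esub>" "\<zero>\<^bsub>M\<^esub>"] by simp
  then show ?thesis using act_closed[OF r M.zero_closed]
    by (metis M.add.r_cancel_one')
qed

lemma zero_act: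
  assumes m: "m \<in> carrier M" shows "\<zero>\<^bsub>R\<^esub> \<odot>\<^bsub>M\<^esub> m = \<zero>\<^bsub>M\<^esub>"
proof -
  have "\<zero>\<^bsub>R\<^esub> \<odot>\<^bsub>M\<^esub> m = \<zero>\<^bsub>R\<^esub> \<odot>\<^bsub>M\<^esub> m \<oplus>\<^bsub>M\<^esub> \<zero>\<^bsub>R\<^esub> \<odot>\<^bsub>M\<^esub> m"
    using act_add_ring[OF _ _ m, of "\<zero>\<^bsub>R\<^esub>" "\<zero>\<^bsub>R\<^esub>"] by simp
  then show ?thesis using act_closed[OF R.zero_closed m]
    by (metis M.add.r_cancel_one')
qed

lemma minus_one_act:
  assumes m: "m \<in> carrier M" shows "(\<ominus>\<^bsub>R\<^esub> \<one>\<^bsub>R\<^esub>) \<odot>\<^bsub>M\<^esub> m \<oplus>\<^bsub>M\<^esub> m = \<zero>\<^bsub>M\<^esub>"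
  using act_add_ring[of "\<ominus>\<^bsub>R\<^esub> \<one>\<^bsub>R\<^esub>" "\<one>\<^bsub>R\<^esub>" m] m by (simp add: act_one zero_act R.l_neg)

end

lemma right_moduleI:
  assumes "ring R" "abelian_group M"
    "\<And>r m. \<lbrakk> r \<in> carrier R; m \<in> carrier M \<rbrakk> \<Longrightarrow> r \<odot>\<^bsub>M\<^esub> m \<in> carrier M"
    "\<And>r s m. \<lbrakk> r \<in> carrier R; s \<in> carrier R; m \<in> carrier M \<rbrakk>
       \<Longrightarrow> (r \<oplus>\<^bsub>R\<^esub> s) \<odot>\<^bsub>M\<^esub> m = r \<odot>\<^bsub>M\<^esub> m \<oplus>\<^bsub>M\<^esub> s \<odot>\<^bsub>M\<^esub> m"
    "\<And>r m n. \<lbrakk> r \<in> carrier R; m \<in> carrier M; n \<in> carrier M \<rbrakk>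
       \<Longrightarrow> r \<odot>\<^bsub>M\<^esub> (m \<oplus>\<^bsub>M\<^esub> n) = r \<odot>\<^bsub>M\<^esub> m \<oplus>\<^bsub>M\<^esub> r \<odot>\<^bsub>M\<^esub> n"
    "\<And>r s m. \<lbrakk> r \<in> carrier R; s \<in> carrier R; m \<in> carrier M \<rbrakk>
       \<Longrightarrow> s \<odot>\<^bsub>M\<^esub> (r \<odot>\<^bsub>M\<^esub> m) = (r \<otimes>\<^bsub>R\<^esub> s) \<odot>\<^bsub>M\<^esub> m"
    "\<And>m. m \<in> carrier M \<Longrightarrow> \<one>\<^bsub>R\<^esub> \<odot>\<^bsub>M\<^esub> m = m"
  shows "right_module R M"
  using assms by (intro right_module.intro right_module_axioms.intro) auto

lemma regular_module_right_module:
  assumes "ring R" shows "right_module R (regular_module R)"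
proof -
  interpret R: ring R by fact
  have "abelian_group (regular_module R)"
  proof (rule abelian_groupI)
    fix x assume "x \<in> carrier (regular_module R)"
    then show "\<exists>y\<in>carrier (regular_module R).
        y \<oplus>\<^bsub>regular_module R\<^esub> x = \<zero>\<^bsub>regular_module R\<^esub>"
      by (intro bexI[of _ "\<ominus>\<^bsub>R\<^esub> x"]) (auto simp: regular_module_def R.l_neg)
  qed (auto simp: regular_module_def R.a_ac)
  then show ?thesis
    by (intro right_moduleI) (auto simp: regular_module_def R.m_assoc R.l_distr R.r_distr assms)
qed

definition is_submodule :: "('r, 'y) ring_scheme \<Rightarrow> ('r, 'm) module \<Rightarrow> 'm set \<Rightarrow> bool" where
  "is_submodule R M N \<longleftrightarrow> N \<subseteq> carrier M \<and> \<zero>\<^bsub>M\<^esub> \<in> N \<and>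
     (\<forall>m\<in>N. \<forall>n\<in>N. m \<oplus>\<^bsub>M\<^esub> n \<in> N) \<and> (\<forall>r\<in>carrier R. \<forall>m\<in>N. r \<odot>\<^bsub>M\<^esub> m \<in> N)"

lemma (in right_module) submodule_right_module:
  assumes "is_submodule R M N" shows "right_module R (M\<lparr>carrier := N\<rparr>)"
proof -
  have sub: "\<And>n. n \<in> N \<Longrightarrow> n \<in> carrier M"
    and cl: "\<zero>\<^bsub>M\<^esub> \<in> N" "\<And>m n. \<lbrakk> m \<in> N; n \<in> N \<rbrakk> \<Longrightarrow> m \<oplus>\<^bsub>M\<^esub> n \<in> N"
      "\<And>r m. \<lbrakk> r \<in> carrier R; m \<in> N \<rbrakk> \<Longrightarrow> r \<odot>\<^bsub>M\<^esub> m \<in> N"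
    using assms unfolding is_submodule_def by auto
  have "abelian_group (M\<lparr>carrier := N\<rparr>)"
  proof (rule abelian_groupI)
    fix x assume "x \<in> carrier (M\<lparr>carrier := N\<rparr>)"
    then have x: "x \<in> N" by simp
    show "\<exists>y\<in>carrier (M\<lparr>carrier := N\<rparr>). y \<oplus>\<^bsub>M\<lparr>carrier := N\<rparr>\<^esub> x = \<zero>\<^bsub>M\<lparr>carrier := N\<rparr>\<^esub>"
      using x cl(3)[of "\<ominus>\<^bsub>R\<^esub> \<one>\<^bsub>R\<^esub>" x] minus_one_act[OF sub[OF x]]
      by (intro bexI[of _ "(\<ominus>\<^bsub>R\<^esub> \<one>\<^bsub>R\<^esub>) \<odot>\<^bsub>M\<^esub> x"]) auto
  qed (auto simp: cl sub M.a_ac)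
  then show ?thesis
    by (intro right_moduleI)
       (auto simp: cl sub act_add_ring act_add_mod act_assoc act_one intro: R.ring_axioms)
qed

inductive_set span :: "('r, 'y) ring_scheme \<Rightarrow> ('r, 'm) module \<Rightarrow> 'm set \<Rightarrow> 'm set"
  for R :: "('r, 'y) ring_scheme" and M :: "('r, 'm) module" and S :: "'m set" where
  span_base: "s \<in> S \<Longrightarrow> s \<in> span R M S"
| span_zero: "\<zero>\<^bsub>M\<^esub> \<in> span R M S"
| span_add: "\<lbrakk> m \<in> span R M S; n \<in> span R M S \<rbrakk> \<Longrightarrow> m \<oplus>\<^bsub>M\<^esub> n \<in> span R M S"
| span_act: "\<lbrakk> r \<in> carrier R; m \<in> span R M S \<rbrakk> \<Longrightarrow> r \<odot>\<^bsub>M\<^esub> m \<in> span R M S"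

lemma span_mono: "S \<subseteq> T \<Longrightarrow> span R M S \<subseteq> span R M T"
proof
  fix m assume "S \<subseteq> T" "m \<in> span R M S"
  from this(2,1) show "m \<in> span R M T" by induction (auto intro: span.intros)
qed

lemma (in right_module) span_is_submodule:
  assumes "S \<subseteq> carrier M" shows "is_submodule R M (span R M S)"
proof -
  have "m \<in> carrier M" if "m \<in> span R M S" for m
    using that assms by induction (auto intro: act_closed)
  then show ?thesis unfolding is_submodule_def by (auto intro: span.intros)
qed

lemma (in right_module) span_empty: "span R M {} = {\<zero>\<^bsub>M\<^esub>}"
proof -
  have "m = \<zero>\<^bsub>M\<^esub>" if "m \<in> span R M {}" for m
    using that by induction (auto simp: act_zero)
  then show ?thesis by (auto intro: span_zero)
qed

text \<open>Hence the span of \<open>insert x S\<close> is a surjective image of the direct sum of the span of \<open>S\<close> with \<open>R\<close>.\<close>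
lemma (in right_module) span_insert:
  assumes S: "S \<subseteq> carrier M" and x: "x \<in> carrier M"
  shows "span R M (insert x S) = {n \<oplus>\<^bsub>M\<^esub> r \<odot>\<^bsub>M\<^esub> x | n r. n \<in> span R M S \<and> r \<in> carrier R}"
    (is "_ = ?T")
proof
  note sub = span_is_submodule[OF S]
  have mem: "n \<in> span R M S \<Longrightarrow> n \<in> carrier M" for n
    using sub unfolding is_submodule_def by auto
  have inT: "n \<oplus>\<^bsub>M\<^esub> r \<odot>\<^bsub>M\<^esub> x \<in> ?T" if "n \<in> span R M S" "r \<in> carrier R" for n r
    using that by blast
  show "span R M (insert x S) \<subseteq> ?T"
  proof
    fix m assume "m \<in> span R M (insert x S)"
    then show "m \<in> ?T"
    proof induction
      case (span_base s)
      show ?case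
      proof (cases "s = x")
        case True
        have "\<zero>\<^bsub>M\<^esub> \<oplus>\<^bsub>M\<^esub> \<one>\<^bsub>R\<^esub> \<odot>\<^bsub>M\<^esub> x = x" using x by (simp add: act_one)
        then show ?thesis using inT[OF span_zero R.one_closed] True by simp
      next
        case False
        then have s: "s \<in> S" using span_base by simp
        then have "s \<oplus>\<^bsub>M\<^esub> \<zero>\<^bsub>R\<^esub> \<odot>\<^bsub>M\<^esub> x = s" using x S by (auto simp: zero_act)
        then show ?thesis using inT[OF span.span_base[OF s] R.zero_closed] by simp
      qed
    next
      case span_zero
      have "\<zero>\<^bsub>M\<^esub> \<oplus>\<^bsub>M\<^esub> \<zero>\<^bsub>R\<^esub> \<odot>\<^bsub>M\<^esub> x = \<zero>\<^bsub>M\<^esub>" using x by (simp add: zero_act)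
      then show ?case using inT[OF span.span_zero R.zero_closed] by simp
    next
      case (span_add m m')
      then obtain n r n' r' where 1: "m = n \<oplus>\<^bsub>M\<^esub> r \<odot>\<^bsub>M\<^esub> x" "n \<in> span R M S" "r \<in> carrier R"
          "m' = n' \<oplus>\<^bsub>M\<^esub> r' \<odot>\<^bsub>M\<^esub> x" "n' \<in> span R M S" "r' \<in> carrier R" by blast
      then have "m \<oplus>\<^bsub>M\<^esub> m' = (n \<oplus>\<^bsub>M\<^esub> n') \<oplus>\<^bsub>M\<^esub> (r \<oplus>\<^bsub>R\<^esub> r') \<odot>\<^bsub>M\<^esub> x"
        using x by (simp add: mem act_add_ring act_closed M.a_ac)
      then show ?case using inT[OF span.span_add[OF 1(2,5)] R.a_closed[OF 1(3,6)]] by simp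
    next
      case (span_act s m)
      then obtain n r where 1: "m = n \<oplus>\<^bsub>M\<^esub> r \<odot>\<^bsub>M\<^esub> x" "n \<in> span R M S" "r \<in> carrier R" by blast
      then have "s \<odot>\<^bsub>M\<^esub> m = s \<odot>\<^bsub>M\<^esub> n \<oplus>\<^bsub>M\<^esub> (r \<otimes>\<^bsub>R\<^esub> s) \<odot>\<^bsub>M\<^esub> x"
        using x span_act by (simp add: mem act_add_mod act_closed act_assoc)
      then show ?case
        using inT[OF span.span_act[OF span_act(1) 1(2)] R.m_closed[OF 1(3) span_act(1)]] by simp
    qed
  qed
  show "?T \<subseteq> span R M (insert x S)"
    using span_mono[of S "insert x S" R M] by (auto intro!: span_add span_act intro: span_base)
qed

text \<open>
  The direct sum of two modules.  Its elements have to live in the carrier type again, so pairs are coded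
  by an injection \<open>e\<close>.
\<close>
definition pair_module ::
  "('u \<times> 'u \<Rightarrow> 'u) \<Rightarrow> ('r, 'u) module \<Rightarrow> ('r, 'u) module \<Rightarrow> ('r, 'u) module" where
  "pair_module e M N = \<lparr>
     carrier = e ` (carrier M \<times> carrier N), mult = undefined, one = undefined,
     zero = e (\<zero>\<^bsub>M\<^esub>, \<zero>\<^bsub>N\<^esub>),
     add = (\<lambda>s t. e (fst (inv_into UNIV e s) \<oplus>\<^bsub>M\<^esub> fst (inv_into UNIV e t), snd (inv_into UNIV e s) \<oplus>\<^bsub>N\<^esub> snd (inv_into UNIV e t))),
     smult = (\<lambda>r s. e (r \<odot>\<^bsub>M\<^esub> fst (inv_into UNIV e s), r \<odot>\<^bsub>N\<^esub> snd (inv_into UNIV e s))) \<rparr>"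

lemma pair_module_right_module:
  assumes "right_module R M" "right_module R N" and e: "inj e"
  shows "right_module R (pair_module e M N)"
proof -
  interpret M: right_module R M by fact
  interpret N: right_module R N by fact
  let ?P = "pair_module e M N"
  have car: "carrier ?P = e ` (carrier M \<times> carrier N)" by (simp add: pair_module_def)
  have zero: "\<zero>\<^bsub>?P\<^esub> = e (\<zero>\<^bsub>M\<^esub>, \<zero>\<^bsub>N\<^esub>)" by (simp add: pair_module_def)
  have add: "e (m, n) \<oplus>\<^bsub>?P\<^esub> e (m', n') = e (m \<oplus>\<^bsub>M\<^esub> m', n \<oplus>\<^bsub>N\<^esub> n')" for m n m' n'
    by (simp add: pair_module_def e)
  have act: "r \<odot>\<^bsub>?P\<^esub> e (m, n) = e (r \<odot>\<^bsub>M\<^esub> m, r \<odot>\<^bsub>N\<^esub> n)" for r m n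
    by (simp add: pair_module_def e)
  have "abelian_group ?P"
  proof (rule abelian_groupI)
    fix x assume "x \<in> carrier ?P"
    then obtain m n where x: "x = e (m, n)" "m \<in> carrier M" "n \<in> carrier N"
      by (auto simp: car)
    then show "\<exists>y\<in>carrier ?P. y \<oplus>\<^bsub>?P\<^esub> x = \<zero>\<^bsub>?P\<^esub>"
      by (intro bexI[of _ "e (\<ominus>\<^bsub>M\<^esub> m, \<ominus>\<^bsub>N\<^esub> n)"]) (auto simp: car add zero M.M.l_neg N.M.l_neg)
  qed (auto simp: car add zero M.M.a_ac N.M.a_ac)
  then show ?thesis
    by (intro right_moduleI)
       (auto simp: car add act M.act_add_ring M.act_add_mod M.act_assoc M.act_one M.act_closed
           N.act_add_ring N.act_add_mod N.act_assoc N.act_one N.act_closed intro: M.R.ring_axioms)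
qed

section \<open>Cokernels and adjoint functors\<close>

context preadditive_category
begin

lemma Hom_zero_closed: "\<lbrakk> X \<in> Obj C; Y \<in> Obj C \<rbrakk> \<Longrightarrow> \<zero>\<^bsub>Hom C X Y\<^esub> \<in> arr C X Y"
  by (rule abelian_groupE(2)[OF Hom_group])

lemma Hom_add_closed:
  "\<lbrakk> X \<in> Obj C; Y \<in> Obj C; f \<in> arr C X Y; g \<in> arr C X Y \<rbrakk>
    \<Longrightarrow> f \<oplus>\<^bsub>Hom C X Y\<^esub> g \<in> arr C X Y"
  by (rule abelian_groupE(1)[OF Hom_group])

lemma Hom_idem_zero:
  assumes "X \<in> Obj C" "Y \<in> Obj C" "f \<in> arr C X Y" "f \<oplus>\<^bsub>Hom C X Y\<^esub> f = f"
  shows "f = \<zero>\<^bsub>Hom C X Y\<^esub>"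
proof -
  interpret H: abelian_group "Hom C X Y" using assms by (intro Hom_group)
  show ?thesis using assms(3,4) H.add.r_cancel_one[of f f] by simp
qed

lemma Comp_zero_right:
  assumes "X \<in> Obj C" "Y \<in> Obj C" "Z \<in> Obj C" "g \<in> arr C Y Z"
  shows "Comp C X Y Z g \<zero>\<^bsub>Hom C X Y\<^esub> = \<zero>\<^bsub>Hom C X Z\<^esub>"
proof (rule Hom_idem_zero[OF assms(1,3)])
  note z = Hom_zero_closed[OF assms(1,2)]
  interpret H: abelian_group "Hom C X Y" using assms by (intro Hom_group)
  show "Comp C X Y Z g \<zero>\<^bsub>Hom C X Y\<^esub> \<in> arr C X Z" using assms z by (intro Comp_closed)
  show "Comp C X Y Z g \<zero>\<^bsub>Hom C X Y\<^esub> \<oplus>\<^bsub>Hom C X Z\<^esub> Comp C X Y Z g \<zero>\<^bsub>Hom C X Y\<^esub> =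
      Comp C X Y Z g \<zero>\<^bsub>Hom C X Y\<^esub>"
    using Comp_add_right[OF assms(1-3) z z assms(4)] by simp
qed

lemma Comp_zero_left:
  assumes "X \<in> Obj C" "Y \<in> Obj C" "Z \<in> Obj C" "f \<in> arr C X Y"
  shows "Comp C X Y Z \<zero>\<^bsub>Hom C Y Z\<^esub> f = \<zero>\<^bsub>Hom C X Z\<^esub>"
proof (rule Hom_idem_zero[OF assms(1,3)])
  note z = Hom_zero_closed[OF assms(2,3)]
  interpret H: abelian_group "Hom C Y Z" using assms by (intro Hom_group)
  show "Comp C X Y Z \<zero>\<^bsub>Hom C Y Z\<^esub> f \<in> arr C X Z" using assms z by (intro Comp_closed)
  show "Comp C X Y Z \<zero>\<^bsub>Hom C Y Z\<^esub> f \<oplus>\<^bsub>Hom C X Z\<^esub> Comp C X Y Z \<zero>\<^bsub>Hom C Y Z\<^esub> f =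
      Comp C X Y Z \<zero>\<^bsub>Hom C Y Z\<^esub> f"
    using Comp_add_left[OF assms(1-4) z z] by simp
qed

end

lemma is_kernel_factor:
  assumes "is_kernel C X Y f K i" "W \<in> Obj C" "g \<in> arr C W X"
    "Comp C W X Y f g = \<zero>\<^bsub>Hom C W Y\<^esub>"
  obtains h where "h \<in> arr C W K" "Comp C W K X i h = g"
proof -
  have "\<exists>!h. h \<in> arr C W K \<and> Comp C W K X i h = g"
    using assms unfolding is_kernel_def by simp
  then show ?thesis using that by (elim ex1E conjE)
qed

lemma is_cokernel_factor:
  assumes "is_cokernel C X Y f Q q" "Z \<in> Obj C" "g \<in> arr C Y Z"
    "Comp C X Y Z g f = \<zero>\<^bsub>Hom C X Z\<^esub>"
  obtains h where "h \<in> arr C Q Z" "Comp C Y Q Z h q = g"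
proof -
  have "\<exists>!h. h \<in> arr C Q Z \<and> Comp C Y Q Z h q = g"
    using assms unfolding is_cokernel_def by simp
  then show ?thesis using that by (elim ex1E conjE)
qed

text \<open>
  The existence part of the fact that \<open>Z\<close> is the cokernel of \<open>f\<close> if \<open>X \<rightarrow> Y \<rightarrow> Z \<rightarrow> 0\<close> is exact.  Exactness is
  expressed by kernels, and \<open>g\<close>, being epic, is a cokernel of some \<open>u\<close>.  Now \<open>u\<close> factors through the kernel of \<open>g\<close>, i.e. through the
  image of \<open>f\<close>, and an arrow that kills \<open>f\<close> kills this image and therefore \<open>u\<close>.
\<close>
lemma (in abelian_category) exact_epic_factor:
  assumes X: "X \<in> Obj C" and Y: "Y \<in> Obj C" and Z: "Z \<in> Obj C" and N: "N \<in> Obj C"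
    and ex: "exact_at C X Y Z f g" and epi: "epic C Y Z g"
    and t: "t \<in> arr C Y N" and tf: "Comp C X Y N t f = \<zero>\<^bsub>Hom C X N\<^esub>"
  shows "\<exists>h\<in>arr C Z N. Comp C Y Z N h g = t"
proof -
  obtain Q q I i where q: "is_cokernel C X Y f Q q" and i: "is_kernel C Y Q q I i"
      and i': "is_kernel C Y Z g I i" and f: "f \<in> arr C X Y" and g: "g \<in> arr C Y Z"
    using ex unfolding exact_at_def by auto
  obtain W u where W: "W \<in> Obj C" and u: "u \<in> arr C W Y" and cok: "is_cokernel C W Y u Z g"
    using epic_is_cokernel[OF Y Z epi] by auto
  have Q: "Q \<in> Obj C" and qa: "q \<in> arr C Y Q" using q unfolding is_cokernel_def by auto
  have I: "I \<in> Obj C" and ia: "i \<in> arr C I Y" and qi: "Comp C I Y Q q i = \<zero>\<^bsub>Hom C I Q\<^esub>"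
    using i unfolding is_kernel_def by auto
  obtain t' where t': "t' \<in> arr C Q N" "Comp C Y Q N t' q = t"
    by (rule is_cokernel_factor[OF q N t tf])
  have gu: "Comp C W Y Z g u = \<zero>\<^bsub>Hom C W Z\<^esub>" using cok unfolding is_cokernel_def by simp
  obtain u' where u': "u' \<in> arr C W I" "Comp C W I Y i u' = u"
    by (rule is_kernel_factor[OF i' W u gu])
  have "Comp C I Y N t i = \<zero>\<^bsub>Hom C I N\<^esub>"
    using Comp_assoc[OF I Y Q N ia qa t'(1)] qi t' Comp_zero_right[OF I Q N t'(1)] by simp
  then have tu: "Comp C W Y N t u = \<zero>\<^bsub>Hom C W N\<^esub>"
    using Comp_assoc[OF W I Y N u'(1) ia t] u' Comp_zero_left[OF W I N u'(1)] by simp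
  show ?thesis by (rule is_cokernel_factor[OF cok N t tu]) blast
qed

text \<open>The condition on a family of bijections in the definition of a left adjoint.\<close>
definition adjunction ::
  "('k, 'o, 'a) cat \<Rightarrow> ('k, 'o, 'a) cat \<Rightarrow> ('l, 'p, 'b) cat \<Rightarrow>
   ('o, 'a, 'p, 'b) func \<Rightarrow> ('p, 'b, 'o, 'a) func \<Rightarrow> ('o \<Rightarrow> 'p \<Rightarrow> 'b \<Rightarrow> 'a) \<Rightarrow> bool" where
  "adjunction C D A L G \<phi> \<longleftrightarrow>
     (\<forall>X\<in>Obj C. \<forall>N\<in>Obj A. bij_betw (\<phi> X N) (arr A (FObj L X) N) (arr D X (FObj G N))) \<and>
     (\<forall>X\<in>Obj C. \<forall>X'\<in>Obj C. \<forall>N\<in>Obj A. \<forall>u\<in>arr C X' X. \<forall>g\<in>arr A (FObj L X) N.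
        \<phi> X' N (Comp A (FObj L X') (FObj L X) N g (FMap L X' X u)) =
        Comp D X' X (FObj G N) (\<phi> X N g) u) \<and>
     (\<forall>X\<in>Obj C. \<forall>N\<in>Obj A. \<forall>N'\<in>Obj A. \<forall>h\<in>arr A N N'. \<forall>g\<in>arr A (FObj L X) N.
        \<phi> X N' (Comp A (FObj L X) N N' h g) =
        Comp D X (FObj G N) (FObj G N') (FMap G N N' h) (\<phi> X N g))"

lemma is_left_adjoint_iff:
  "is_left_adjoint C D A L G \<longleftrightarrow>
    is_functor C A L \<and> is_functor A D G \<and> (\<exists>\<phi>. adjunction C D A L G \<phi>)"
  unfolding is_left_adjoint_def adjunction_def by (rule refl)

lemma adjunction_bij:
  "\<lbrakk> adjunction C D A L G \<phi>; X \<in> Obj C; N \<in> Obj A \<rbrakk>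
    \<Longrightarrow> bij_betw (\<phi> X N) (arr A (FObj L X) N) (arr D X (FObj G N))"
  unfolding adjunction_def by simp

lemma adjunction_natural_left:
  "\<lbrakk> adjunction C D A L G \<phi>; X \<in> Obj C; X' \<in> Obj C; N \<in> Obj A; u \<in> arr C X' X; g \<in> arr A (FObj L X) N \<rbrakk>
    \<Longrightarrow> \<phi> X' N (Comp A (FObj L X') (FObj L X) N g (FMap L X' X u)) =
        Comp D X' X (FObj G N) (\<phi> X N g) u"
  unfolding adjunction_def by simp

lemma adjunction_natural_right:
  "\<lbrakk> adjunction C D A L G \<phi>; X \<in> Obj C; N \<in> Obj A; N' \<in> Obj A; h \<in> arr A N N'; g \<in> arr A (FObj L X) N \<rbrakk>
    \<Longrightarrow> \<phi> X N' (Comp A (FObj L X) N N' h g) =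
        Comp D X (FObj G N) (FObj G N') (FMap G N N' h) (\<phi> X N g)"
  unfolding adjunction_def by simp

text \<open>
  The usual argument by the Yoneda lemma: \<open>\<eta> X\<close> and its inverse correspond to the identities of
  \<open>L' X\<close> and \<open>L X\<close> under the two adjunctions, and all equations are checked after transposition.
  Compositions in \<open>D\<close> occur only inside the naturality equations, so the argument also covers left
  adjoints relative to an inclusion.
\<close>
lemma left_adjoint_unique:
  assumes A: "category A"
    and L: "is_left_adjoint C D A L G" and L': "is_left_adjoint C D A L' G"
  shows "\<exists>\<eta>. natural_iso C A L L' \<eta>"
proof -
  interpret A: category A by fact
  obtain \<phi> where adj: "adjunction C D A L G \<phi>" using L unfolding is_left_adjoint_iff by auto
  obtain \<psi> where adj': "adjunction C D A L' G \<psi>" using L' unfolding is_left_adjoint_iff by auto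
  note \<phi> = adjunction_bij[OF adj] and \<phi>1 = adjunction_natural_left[OF adj]
    and \<phi>2 = adjunction_natural_right[OF adj]
  note \<psi> = adjunction_bij[OF adj'] and \<psi>1 = adjunction_natural_left[OF adj']
    and \<psi>2 = adjunction_natural_right[OF adj']
  have Lo: "\<And>X. X \<in> Obj C \<Longrightarrow> FObj L X \<in> Obj A" and L'o: "\<And>X. X \<in> Obj C \<Longrightarrow> FObj L' X \<in> Obj A"
    and Lm: "\<And>X Y f. \<lbrakk> X \<in> Obj C; Y \<in> Obj C; f \<in> arr C X Y \<rbrakk> \<Longrightarrow> FMap L X Y f \<in> arr A (FObj L X) (FObj L Y)"
    and L'm: "\<And>X Y f. \<lbrakk> X \<in> Obj C; Y \<in> Obj C; f \<in> arr C X Y \<rbrakk> \<Longrightarrow> FMap L' X Y f \<in> arr A (FObj L' X) (FObj L' Y)"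
    using L L' unfolding is_left_adjoint_iff is_functor_def by simp_all
  define \<eta> where "\<eta> X = inv_into (arr A (FObj L X) (FObj L' X)) (\<phi> X (FObj L' X))
      (\<psi> X (FObj L' X) (Idt A (FObj L' X)))" for X
  define \<theta> where "\<theta> X = inv_into (arr A (FObj L' X) (FObj L X)) (\<psi> X (FObj L X))
      (\<phi> X (FObj L X) (Idt A (FObj L X)))" for X
  have \<eta>: "\<eta> X \<in> arr A (FObj L X) (FObj L' X)"
      "\<phi> X (FObj L' X) (\<eta> X) = \<psi> X (FObj L' X) (Idt A (FObj L' X))" if X: "X \<in> Obj C" for X
  proof -
    have "\<psi> X (FObj L' X) (Idt A (FObj L' X)) \<in> \<phi> X (FObj L' X) ` arr A (FObj L X) (FObj L' X)"
      unfolding bij_betw_imp_surj_on[OF \<phi>[OF X L'o[OF X]]]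
      by (rule bij_betw_apply[OF \<psi>[OF X L'o[OF X]] A.Idt_closed[OF L'o[OF X]]])
    then show "\<eta> X \<in> arr A (FObj L X) (FObj L' X)"
        "\<phi> X (FObj L' X) (\<eta> X) = \<psi> X (FObj L' X) (Idt A (FObj L' X))"
      unfolding \<eta>_def by (rule inv_into_into, rule f_inv_into_f)
  qed
  have \<theta>: "\<theta> X \<in> arr A (FObj L' X) (FObj L X)"
      "\<psi> X (FObj L X) (\<theta> X) = \<phi> X (FObj L X) (Idt A (FObj L X))" if X: "X \<in> Obj C" for X
  proof -
    have "\<phi> X (FObj L X) (Idt A (FObj L X)) \<in> \<psi> X (FObj L X) ` arr A (FObj L' X) (FObj L X)"
      unfolding bij_betw_imp_surj_on[OF \<psi>[OF X Lo[OF X]]]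
      by (rule bij_betw_apply[OF \<phi>[OF X Lo[OF X]] A.Idt_closed[OF Lo[OF X]]])
    then show "\<theta> X \<in> arr A (FObj L' X) (FObj L X)"
        "\<psi> X (FObj L X) (\<theta> X) = \<phi> X (FObj L X) (Idt A (FObj L X))"
      unfolding \<theta>_def by (rule inv_into_into, rule f_inv_into_f)
  qed
  have iso: "isomorphism A (FObj L X) (FObj L' X) (\<eta> X)" if X: "X \<in> Obj C" for X
  proof -
    note o = Lo[OF X] L'o[OF X] and e = \<eta>[OF X] and t = \<theta>[OF X]
    have "\<phi> X (FObj L X) (Comp A (FObj L X) (FObj L' X) (FObj L X) (\<theta> X) (\<eta> X)) =
        \<phi> X (FObj L X) (Idt A (FObj L X))"
      using \<phi>2[OF X o(2,1) t(1) e(1)] \<psi>2[OF X o(2,1) t(1) A.Idt_closed[OF o(2)]] e(2) t(2)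
        A.Comp_Idt[OF o(2,1) t(1)] by simp
    then have 1: "Comp A (FObj L X) (FObj L' X) (FObj L X) (\<theta> X) (\<eta> X) = Idt A (FObj L X)"
      by (rule inj_onD[OF bij_betw_imp_inj_on[OF \<phi>[OF X o(1)]] _
          A.Comp_closed[OF o(1,2,1) e(1) t(1)] A.Idt_closed[OF o(1)]])
    have "\<psi> X (FObj L' X) (Comp A (FObj L' X) (FObj L X) (FObj L' X) (\<eta> X) (\<theta> X)) =
        \<psi> X (FObj L' X) (Idt A (FObj L' X))"
      using \<psi>2[OF X o(1,2) e(1) t(1)] \<phi>2[OF X o(1,2) e(1) A.Idt_closed[OF o(1)]] e(2) t(2)
        A.Comp_Idt[OF o(1,2) e(1)] by simp
    then have 2: "Comp A (FObj L' X) (FObj L X) (FObj L' X) (\<eta> X) (\<theta> X) = Idt A (FObj L' X)"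
      by (rule inj_onD[OF bij_betw_imp_inj_on[OF \<psi>[OF X o(2)]] _
          A.Comp_closed[OF o(2,1,2) t(1) e(1)] A.Idt_closed[OF o(2)]])
    show ?thesis unfolding isomorphism_def using 1 2 e(1) t(1) by blast
  qed
  have nat: "Comp A (FObj L X) (FObj L Y) (FObj L' Y) (\<eta> Y) (FMap L X Y f) =
      Comp A (FObj L X) (FObj L' X) (FObj L' Y) (FMap L' X Y f) (\<eta> X)" (is "?a = ?b")
    if X: "X \<in> Obj C" and Y: "Y \<in> Obj C" and f: "f \<in> arr C X Y" for X Y f
  proof -
    note o = Lo[OF X] L'o[OF X] Lo[OF Y] L'o[OF Y]
    have "\<phi> X (FObj L' Y) ?a = \<psi> X (FObj L' Y) (FMap L' X Y f)"
      using \<phi>1[OF Y X o(4) f \<eta>(1)[OF Y]] \<psi>1[OF Y X o(4) f A.Idt_closed[OF o(4)]] \<eta>(2)[OF Y]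
        A.Idt_Comp[OF o(2,4) L'm[OF X Y f]] by simp
    also have "\<dots> = \<phi> X (FObj L' Y) ?b"
      using \<phi>2[OF X o(2,4) L'm[OF X Y f] \<eta>(1)[OF X]]
        \<psi>2[OF X o(2,4) L'm[OF X Y f] A.Idt_closed[OF o(2)]] \<eta>(2)[OF X]
        A.Comp_Idt[OF o(2,4) L'm[OF X Y f]] by simp
    finally show ?thesis
      by (rule inj_onD[OF bij_betw_imp_inj_on[OF \<phi>[OF X o(4)]] _
          A.Comp_closed[OF o(1,3,4) Lm[OF X Y f] \<eta>(1)[OF Y]]
          A.Comp_closed[OF o(1,2,4) \<eta>(1)[OF X] L'm[OF X Y f]]])
  qed
  have "natural_iso C A L L' \<eta>" unfolding natural_iso_def using iso nat by simp
  then show ?thesis by (intro exI)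
qed

section \<open>The category of right modules\<close>

lemma Mod_Obj: "M \<in> Obj (Mod R \<gamma> U) \<longleftrightarrow> right_module R M \<and> carrier M \<in> U"
  by (simp add: Mod_def)

lemma Mod_simps [simp]:
  "arr (Mod R \<gamma> U) M N = rmod_hom R M N"
  "zero (Hom (Mod R \<gamma> U) M N) = (\<lambda>m\<in>carrier M. \<zero>\<^bsub>N\<^esub>)"
  "add (Hom (Mod R \<gamma> U) M N) f g = (\<lambda>m\<in>carrier M. f m \<oplus>\<^bsub>N\<^esub> g m)"
  "smult (Hom (Mod R \<gamma> U) M N) a f = (\<lambda>m\<in>carrier M. \<gamma> a \<odot>\<^bsub>N\<^esub> f m)"
  "Idt (Mod R \<gamma> U) M = (\<lambda>m\<in>carrier M. m)"
  "Comp (Mod R \<gamma> U) M N P g f = compose (carrier M) g f"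
  by (simp_all add: Mod_def)

lemma rmod_homI:
  assumes "\<And>m. m \<in> carrier M \<Longrightarrow> f m \<in> carrier N" "\<And>m. m \<notin> carrier M \<Longrightarrow> f m = undefined"
    "\<And>m n. \<lbrakk> m \<in> carrier M; n \<in> carrier M \<rbrakk> \<Longrightarrow> f (m \<oplus>\<^bsub>M\<^esub> n) = f m \<oplus>\<^bsub>N\<^esub> f n"
    "\<And>r m. \<lbrakk> r \<in> carrier R; m \<in> carrier M \<rbrakk> \<Longrightarrow> f (r \<odot>\<^bsub>M\<^esub> m) = r \<odot>\<^bsub>N\<^esub> f m"
  shows "f \<in> rmod_hom R M N"
  using assms by (simp add: rmod_hom_def PiE_iff extensional_def)

lemma rmod_hom_closed: "\<lbrakk> f \<in> rmod_hom R M N; m \<in> carrier M \<rbrakk> \<Longrightarrow> f m \<in> carrier N"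
  by (auto simp: rmod_hom_def)

lemma rmod_hom_add:
  "\<lbrakk> f \<in> rmod_hom R M N; m \<in> carrier M; n \<in> carrier M \<rbrakk> \<Longrightarrow> f (m \<oplus>\<^bsub>M\<^esub> n) = f m \<oplus>\<^bsub>N\<^esub> f n"
  by (simp add: rmod_hom_def)

lemma rmod_hom_act:
  "\<lbrakk> f \<in> rmod_hom R M N; r \<in> carrier R; m \<in> carrier M \<rbrakk> \<Longrightarrow> f (r \<odot>\<^bsub>M\<^esub> m) = r \<odot>\<^bsub>N\<^esub> f m"
  by (simp add: rmod_hom_def)

lemma rmod_hom_undefined: "\<lbrakk> f \<in> rmod_hom R M N; m \<notin> carrier M \<rbrakk> \<Longrightarrow> f m = undefined"
  by (auto simp: rmod_hom_def)

lemma rmod_hom_eqI: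
  assumes "f \<in> rmod_hom R M N" "g \<in> rmod_hom R M N'" "\<And>m. m \<in> carrier M \<Longrightarrow> f m = g m"
  shows "f = g"
proof
  fix m show "f m = g m"
    using assms rmod_hom_undefined[OF assms(1)] rmod_hom_undefined[OF assms(2)]
    by (cases "m \<in> carrier M") simp_all
qed

lemma rmod_hom_zero:
  assumes "right_module R M" "abelian_group N" and f: "f \<in> rmod_hom R M N"
  shows "f \<zero>\<^bsub>M\<^esub> = \<zero>\<^bsub>N\<^esub>"
proof -
  interpret M: right_module R M by fact
  interpret N: abelian_group N by fact
  have "f \<zero>\<^bsub>M\<^esub> \<oplus>\<^bsub>N\<^esub> f \<zero>\<^bsub>M\<^esub> = f \<zero>\<^bsub>M\<^esub>"
    using rmod_hom_add[OF f M.M.zero_closed M.M.zero_closed] by simp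
  then show ?thesis
    using N.add.r_cancel_one[of "f \<zero>\<^bsub>M\<^esub>" "f \<zero>\<^bsub>M\<^esub>"] rmod_hom_closed[OF f M.M.zero_closed] by simp
qed

lemma rmod_hom_compose:
  assumes "right_module R M" "f \<in> rmod_hom R M N" "g \<in> rmod_hom R N P"
  shows "compose (carrier M) g f \<in> rmod_hom R M P"
proof -
  interpret M: right_module R M by fact
  note f = rmod_hom_closed[OF assms(2)] rmod_hom_add[OF assms(2)] rmod_hom_act[OF assms(2)]
  note g = rmod_hom_closed[OF assms(3)] rmod_hom_add[OF assms(3)] rmod_hom_act[OF assms(3)]
  show ?thesis by (rule rmod_homI) (simp_all add: compose_def f g M.act_closed)
qed

lemma inclusion_rmod_hom:
  assumes "N \<subseteq> N'" "right_module R (M\<lparr>carrier := N\<rparr>)"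
  shows "(\<lambda>m\<in>N. m) \<in> rmod_hom R (M\<lparr>carrier := N\<rparr>) (M\<lparr>carrier := N'\<rparr>)"
proof -
  interpret N: right_module R "M\<lparr>carrier := N\<rparr>" by fact
  show ?thesis
    using assms(1) N.M.a_closed N.act_closed by (intro rmod_homI) (auto simp: subset_iff)
qed

text \<open>Every homomorphism from the regular module to \<open>M\<close> is an orbit map.\<close>
definition orbit_map :: "('u, 'y) ring_scheme \<Rightarrow> ('u, 'm) module \<Rightarrow> 'm \<Rightarrow> 'u \<Rightarrow> 'm" where
  "orbit_map R M m = (\<lambda>r\<in>carrier R. r \<odot>\<^bsub>M\<^esub> m)"

lemma orbit_map_rmod_hom:
  assumes "right_module R M" "m \<in> carrier M"
  shows "orbit_map R M m \<in> rmod_hom R (regular_module R) M"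
proof -
  interpret M: right_module R M by fact
  show ?thesis using assms(2)
    by (intro rmod_homI)
       (simp_all add: orbit_map_def regular_module_def M.act_closed M.act_add_ring M.act_assoc)
qed

lemma orbit_map_regular: "orbit_map R (regular_module R) x = left_mult R x"
  by (simp add: orbit_map_def left_mult_def regular_module_def)

text \<open>
  The inclusion of the set-theoretic kernel is a categorical kernel, and the surjection \<open>f\<close> is its cokernel;
  the two together are exactness at \<open>P\<close>.
\<close>
lemma exact_inclusion_of_kernel:
  assumes P: "right_module R P" and M: "right_module R M"
    and f: "f \<in> rmod_hom R P M" and surj: "f ` carrier P = carrier M"
    and K: "K = P\<lparr>carrier := {p \<in> carrier P. f p = \<zero>\<^bsub>M\<^esub>}\<rparr>"
    and small: "carrier P \<in> U" "carrier M \<in> U" "carrier K \<in> U"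
  shows "K \<in> Obj (Mod R \<gamma> U)" "(\<lambda>p\<in>carrier K. p) \<in> rmod_hom R K P"
    "exact_at (Mod R \<gamma> U) K P M (\<lambda>p\<in>carrier K. p) f" "epic (Mod R \<gamma> U) P M f"
proof -
  interpret P: right_module R P by fact
  interpret M: right_module R M by fact
  note fs = rmod_hom_closed[OF f] rmod_hom_add[OF f] rmod_hom_act[OF f]
  have f0: "f \<zero>\<^bsub>P\<^esub> = \<zero>\<^bsub>M\<^esub>" by (rule rmod_hom_zero[OF P M.M.abelian_group_axioms f])
  have cK: "x \<in> carrier K \<longleftrightarrow> x \<in> carrier P \<and> f x = \<zero>\<^bsub>M\<^esub>" for x by (simp add: K)
  have ops: "add K = add P" "zero K = zero P" "smult K = smult P" by (simp_all add: K)
  have "is_submodule R P {p \<in> carrier P. f p = \<zero>\<^bsub>M\<^esub>}"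
    by (auto simp: is_submodule_def f0 fs P.act_closed M.act_zero)
  then have rK: "right_module R K" unfolding K by (rule P.submodule_right_module)
  then show KO: "K \<in> Obj (Mod R \<gamma> U)" using small by (simp add: Mod_Obj)
  interpret K: right_module R K by fact
  let ?k = "\<lambda>p\<in>carrier K. p"
  show k: "?k \<in> rmod_hom R K P"
    using inclusion_rmod_hom[of "carrier K" "carrier P" R P] rK unfolding K by auto
  have PO: "P \<in> Obj (Mod R \<gamma> U)" and MO: "M \<in> Obj (Mod R \<gamma> U)"
    using P M small by (simp_all add: Mod_Obj)
  have fk: "compose (carrier K) f ?k = (\<lambda>p\<in>carrier K. \<zero>\<^bsub>M\<^esub>)"
    by (rule ext) (simp add: compose_def restrict_def cK)
  have ker: "is_kernel (Mod R \<gamma> U) P M f K ?k"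
    unfolding is_kernel_def Mod_simps
  proof (intro conjI ballI impI)
    fix W g assume W: "W \<in> Obj (Mod R \<gamma> U)" and g: "g \<in> rmod_hom R W P"
      and fg: "compose (carrier W) f g = (\<lambda>m\<in>carrier W. \<zero>\<^bsub>M\<^esub>)"
    have "f (g w) = \<zero>\<^bsub>M\<^esub>" if "w \<in> carrier W" for w
      using fun_cong[OF fg, of w] that by (simp add: compose_def)
    then have gK: "g w \<in> carrier K" if "w \<in> carrier W" for w
      using that rmod_hom_closed[OF g] by (simp add: cK)
    have g': "g \<in> rmod_hom R W K"
      using gK rmod_hom_undefined[OF g] rmod_hom_add[OF g] rmod_hom_act[OF g]
      by (intro rmod_homI) (simp_all add: ops)
    have kh: "compose (carrier W) ?k h = h" if h: "h \<in> rmod_hom R W K" for h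
      using rmod_hom_undefined[OF h] rmod_hom_closed[OF h]
      by (intro ext) (simp add: compose_def restrict_def)
    show "\<exists>!h. h \<in> rmod_hom R W K \<and> compose (carrier W) ?k h = g"
    proof (rule ex1I)
      show "g \<in> rmod_hom R W K \<and> compose (carrier W) ?k g = g" using g' kh by simp
      fix h assume "h \<in> rmod_hom R W K \<and> compose (carrier W) ?k h = g"
      then show "h = g" using kh[of h] by metis
    qed
  qed (use KO k fk in simp_all)
  have epi: "h = h'" if h: "h \<in> rmod_hom R M Z" and h': "h' \<in> rmod_hom R M Z"
      and eq: "compose (carrier P) h f = compose (carrier P) h' f" for h h' Z
  proof (rule rmod_hom_eqI[OF h h'])
    fix m assume "m \<in> carrier M"
    then obtain p where "p \<in> carrier P" "m = f p" unfolding surj[symmetric] by (rule imageE)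
    then show "h m = h' m" using fun_cong[OF eq, of p] by (simp add: compose_def)
  qed
  show "epic (Mod R \<gamma> U) P M f"
    unfolding epic_def Mod_simps using f epi by simp
  have cok: "is_cokernel (Mod R \<gamma> U) K P ?k M f"
    unfolding is_cokernel_def Mod_simps
  proof (intro conjI ballI impI)
    fix Z g assume Z: "Z \<in> Obj (Mod R \<gamma> U)" and g: "g \<in> rmod_hom R P Z"
      and gk: "compose (carrier K) g ?k = (\<lambda>p\<in>carrier K. \<zero>\<^bsub>Z\<^esub>)"
    interpret Z: right_module R Z using Z by (simp add: Mod_Obj)
    have g0: "g p = \<zero>\<^bsub>Z\<^esub>" if "p \<in> carrier P" "f p = \<zero>\<^bsub>M\<^esub>" for p
      using fun_cong[OF gk, of p] that by (simp add: compose_def cK)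
    have gf: "g p = g p'" if p: "p \<in> carrier P" and p': "p' \<in> carrier P" and eq: "f p = f p'" for p p'
    proof -
      \<comment> \<open>the difference lies in the kernel of \<open>f\<close>, hence is killed by \<open>g\<close>\<close>
      let ?d = "p \<oplus>\<^bsub>P\<^esub> \<ominus>\<^bsub>P\<^esub> p'"
      have d: "?d \<in> carrier P" using p p' by simp
      have p_eq: "?d \<oplus>\<^bsub>P\<^esub> p' = p" using p p' by (simp add: P.M.a_assoc P.M.l_neg)
      have "f ?d \<oplus>\<^bsub>M\<^esub> f p' = f p'" using fs(2)[OF d p'] p_eq eq by simp
      then have "f ?d = \<zero>\<^bsub>M\<^esub>"
        using M.M.add.l_cancel_one[of "f p'" "f ?d"] M.M.add.r_cancel_one[of "f p'" "f ?d"] fs(1) d p'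
        by (simp add: M.M.a_comm)
      then have "g ?d = \<zero>\<^bsub>Z\<^esub>" using g0 d by simp
      then show ?thesis
        using rmod_hom_add[OF g d p'] p_eq rmod_hom_closed[OF g p'] by simp
    qed
    define s where "s m = inv_into (carrier P) f m" for m
    have s: "s m \<in> carrier P" "f (s m) = m" if "m \<in> carrier M" for m
      using that unfolding s_def surj[symmetric] by (rule inv_into_into, rule f_inv_into_f)
    define h where "h = (\<lambda>m\<in>carrier M. g (s m))"
    have hf: "h (f p) = g p" if "p \<in> carrier P" for p
      using gf[OF s(1)[OF fs(1)[OF that]] that s(2)[OF fs(1)[OF that]]] fs(1)[OF that]
      by (simp add: h_def)
    have h: "h \<in> rmod_hom R M Z"
    proof (rule rmod_homI)
      fix m assume m: "m \<in> carrier M"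
      show "h m \<in> carrier Z" using rmod_hom_closed[OF g s(1)[OF m]] m by (simp add: h_def)
    next
      fix m assume "m \<notin> carrier M" then show "h m = undefined" by (simp add: h_def)
    next
      fix m n assume m: "m \<in> carrier M" and n: "n \<in> carrier M"
      have "h (f (s m) \<oplus>\<^bsub>M\<^esub> f (s n)) = h (f (s m \<oplus>\<^bsub>P\<^esub> s n))"
        using fs(2)[OF s(1)[OF m] s(1)[OF n]] by simp
      also have "\<dots> = g (s m \<oplus>\<^bsub>P\<^esub> s n)" using s(1)[OF m] s(1)[OF n] by (intro hf) simp
      also have "\<dots> = h m \<oplus>\<^bsub>Z\<^esub> h n"
        using rmod_hom_add[OF g s(1)[OF m] s(1)[OF n]] m n by (simp add: h_def)
      finally show "h (m \<oplus>\<^bsub>M\<^esub> n) = h m \<oplus>\<^bsub>Z\<^esub> h n" using s(2)[OF m] s(2)[OF n] by simp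
    next
      fix r m assume r: "r \<in> carrier R" and m: "m \<in> carrier M"
      have "h (r \<odot>\<^bsub>M\<^esub> f (s m)) = h (f (r \<odot>\<^bsub>P\<^esub> s m))" using fs(3)[OF r s(1)[OF m]] by simp
      also have "\<dots> = g (r \<odot>\<^bsub>P\<^esub> s m)" using P.act_closed[OF r s(1)[OF m]] by (rule hf)
      also have "\<dots> = r \<odot>\<^bsub>Z\<^esub> h m" using rmod_hom_act[OF g r s(1)[OF m]] m by (simp add: h_def)
      finally show "h (r \<odot>\<^bsub>M\<^esub> m) = r \<odot>\<^bsub>Z\<^esub> h m" using s(2)[OF m] by simp
    qed
    have hg: "compose (carrier P) h f = g"
      by (rule rmod_hom_eqI[OF rmod_hom_compose[OF P f h] g]) (simp add: compose_def hf)
    show "\<exists>!h. h \<in> rmod_hom R M Z \<and> compose (carrier P) h f = g"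
    proof (rule ex1I)
      show "h \<in> rmod_hom R M Z \<and> compose (carrier P) h f = g" using h hg by simp
      fix h' assume "h' \<in> rmod_hom R M Z \<and> compose (carrier P) h' f = g"
      then show "h' = h" using epi[of h' Z h] h hg by simp
    qed
  qed (use MO f fk in simp_all)
  show "exact_at (Mod R \<gamma> U) K P M ?k f"
    unfolding exact_at_def Mod_simps using k f ker cok by (intro conjI exI) simp_all
qed

text \<open>
  Any additive functor is controlled on a direct sum by the equation \<open>i \<circ> p + j \<circ> q = 1\<close>.  The values of the
  projections on coded pairs serve to define maps out of the sum.
\<close>
lemma pair_module_identity:
  assumes M: "right_module R M" and N: "right_module R N" and e: "inj e"
    and P: "P = pair_module e M N"
  obtains i j p q where "i \<in> rmod_hom R M P" "j \<in> rmod_hom R N P" "p \<in> rmod_hom R P M" "q \<in> rmod_hom R P N"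
    "\<And>x. x \<in> carrier P \<Longrightarrow> i (p x) \<oplus>\<^bsub>P\<^esub> j (q x) = x"
    "\<And>m n. \<lbrakk> m \<in> carrier M; n \<in> carrier N \<rbrakk> \<Longrightarrow> p (e (m, n)) = m \<and> q (e (m, n)) = n"
proof -
  interpret M: right_module R M by fact
  interpret N: right_module R N by fact
  have car: "carrier P = e ` (carrier M \<times> carrier N)" by (simp add: P pair_module_def)
  have add: "e (m, n) \<oplus>\<^bsub>P\<^esub> e (m', n') = e (m \<oplus>\<^bsub>M\<^esub> m', n \<oplus>\<^bsub>N\<^esub> n')" for m n m' n'
    by (simp add: P pair_module_def e)
  have act: "r \<odot>\<^bsub>P\<^esub> e (m, n) = e (r \<odot>\<^bsub>M\<^esub> m, r \<odot>\<^bsub>N\<^esub> n)" for r m n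
    by (simp add: P pair_module_def e)
  interpret P: right_module R P unfolding P by (rule pair_module_right_module[OF M N e])
  have elim: "\<exists>m\<in>carrier M. \<exists>n\<in>carrier N. x = e (m, n)" if "x \<in> carrier P" for x
    using that by (auto simp: car)
  have mem: "e (m, n) \<in> carrier P" if "m \<in> carrier M" "n \<in> carrier N" for m n
    using that by (simp add: car)
  let ?i = "\<lambda>m\<in>carrier M. e (m, \<zero>\<^bsub>N\<^esub>)" and ?j = "\<lambda>n\<in>carrier N. e (\<zero>\<^bsub>M\<^esub>, n)"
  let ?p = "\<lambda>x\<in>carrier P. fst (inv_into UNIV e x)" and ?q = "\<lambda>x\<in>carrier P. snd (inv_into UNIV e x)"
  show ?thesis
  proof (rule that)
    show "?i \<in> rmod_hom R M P"
      by (rule rmod_homI) (simp_all add: mem add act M.act_closed N.act_zero)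
    show "?j \<in> rmod_hom R N P"
      by (rule rmod_homI) (simp_all add: mem add act N.act_closed M.act_zero)
    show "?p \<in> rmod_hom R P M"
      by (rule rmod_homI) (auto dest!: elim simp: mem e inj_eq[OF e] add act M.act_closed N.act_closed)
    show "?q \<in> rmod_hom R P N"
      by (rule rmod_homI) (auto dest!: elim simp: mem e inj_eq[OF e] add act M.act_closed N.act_closed)
    show "?i (?p x) \<oplus>\<^bsub>P\<^esub> ?j (?q x) = x" if "x \<in> carrier P" for x
      using elim[OF that] by (auto simp: mem e add)
    show "?p (e (m, n)) = m \<and> ?q (e (m, n)) = n" if "m \<in> carrier M" "n \<in> carrier N" for m n
      using that by (simp add: mem e)
  qed
qed

section \<open>Modules as direct limits of finitely generated submodules\<close>

text \<open>
  A directed family of submodules that captures every finite set of elements has the whole module as its direct limit: a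
  map on \<open>M\<close> is defined elementwise, and additivity is checked in a member that contains both summands.
\<close>
lemma is_direct_limit_of_submodules:
  fixes R :: "('r, 'y) ring_scheme" and M :: "('r, 'm) module" and N :: "'i \<Rightarrow> 'm set"
    and \<gamma> :: "'k \<Rightarrow> 'r" and U :: "'m set set"
  defines "C \<equiv> Mod R \<gamma> U" and "X \<equiv> (\<lambda>i. M\<lparr>carrier := N i\<rparr>)" and "t \<equiv> (\<lambda>i (j :: 'i). \<lambda>m\<in>N i. m)"
  assumes U: "small_universe U" and M: "M \<in> Obj C"
    and N: "\<And>i. i \<in> I \<Longrightarrow> is_submodule R M (N i)"
    and r: "I \<noteq> {}" "partial_order_on I r" "\<And>i j. (i, j) \<in> r \<Longrightarrow> N i \<subseteq> N j"
    and cover: "\<And>F. \<lbrakk> finite F; F \<subseteq> carrier M \<rbrakk> \<Longrightarrow> \<exists>i\<in>I. F \<subseteq> N i"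
    and dir: "\<And>i j. \<lbrakk> i \<in> I; j \<in> I \<rbrakk> \<Longrightarrow> \<exists>l\<in>I. (i, l) \<in> r \<and> (j, l) \<in> r"
  shows "directed_system C I r X t" "is_direct_limit C I r X t M (\<lambda>i. \<lambda>m\<in>N i. m)"
proof -
  interpret M: right_module R M using M by (simp add: C_def Mod_Obj)
  have mem: "m \<in> carrier M" if "i \<in> I" "m \<in> N i" for i m
    using N[OF that(1)] that(2) by (auto simp: is_submodule_def)
  have rI: "i \<in> I \<and> j \<in> I" if "(i, j) \<in> r" for i j
    using r(2) that by (auto simp: partial_order_on_def preorder_on_def)
  have XO: "X i \<in> Obj C" if "i \<in> I" for i
  proof -
    have "carrier M \<in> U" using M by (simp add: C_def Mod_Obj)
    then have "N i \<in> U" using mem[OF that] by (rule small_subset[OF U _ subsetI])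
    then show ?thesis using M.submodule_right_module[OF N[OF that]] by (simp add: C_def X_def Mod_Obj)
  qed
  have XR: "right_module R (M\<lparr>carrier := N i\<rparr>)" if "i \<in> I" for i
    using XO[OF that] by (simp add: C_def X_def Mod_Obj)
  have tC: "t i j \<in> arr C (X i) (X j)" if "(i, j) \<in> r" for i j
    unfolding t_def X_def C_def Mod_simps using rI[OF that] by (intro inclusion_rmod_hom r(3)[OF that] XR) simp
  have comp: "compose (N i) (\<lambda>m\<in>N'. m) (\<lambda>m\<in>N i. m) = (\<lambda>m\<in>N i. m)" if "N i \<subseteq> N'" for i N'
    using that by (intro ext) (auto simp: compose_def restrict_def)
  show sys: "directed_system C I r X t"
    unfolding directed_system_def
  proof (intro conjI)
    show "\<forall>i\<in>I. \<forall>j\<in>I. \<exists>l\<in>I. (i, l) \<in> r \<and> (j, l) \<in> r" using dir by simp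
    show "\<forall>i\<in>I. X i \<in> Obj C" using XO by simp
    show "\<forall>(i, j)\<in>r. t i j \<in> arr C (X i) (X j)" using tC by auto
    show "\<forall>i\<in>I. t i i = Idt C (X i)" by (simp add: t_def C_def X_def)
    show "\<forall>i j l. (i, j) \<in> r \<and> (j, l) \<in> r \<longrightarrow>
        Comp C (X i) (X j) (X l) (t j l) (t i j) = t i l"
      using r(3) by (simp add: t_def C_def X_def comp)
  qed (use r(1,2) in simp_all)
  have cone: "is_cocone C I r X t M (\<lambda>i. \<lambda>m\<in>N i. m)"
    unfolding is_cocone_def
  proof (intro conjI)
    show "\<forall>i\<in>I. (\<lambda>m\<in>N i. m) \<in> arr C (X i) M"
    proof
      fix i assume i: "i \<in> I"
      then have "N i \<subseteq> carrier M" using mem by auto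
      from inclusion_rmod_hom[OF this XR[OF i]]
      show "(\<lambda>m\<in>N i. m) \<in> arr C (X i) M" by (simp add: C_def X_def)
    qed
    show "\<forall>(i, j)\<in>r. Comp C (X i) (X j) M (\<lambda>m\<in>N j. m) (t i j) = (\<lambda>m\<in>N i. m)"
      using r(3) by (auto simp: t_def C_def X_def comp)
  qed (use M in simp)
  show "is_direct_limit C I r X t M (\<lambda>i. \<lambda>m\<in>N i. m)"
    unfolding is_direct_limit_def
  proof (intro conjI allI impI)
    fix Z d assume d: "is_cocone C I r X t Z d"
    have dh: "d i \<in> rmod_hom R (X i) Z" if "i \<in> I" for i
      using d that by (simp add: is_cocone_def C_def)
    have dc: "d i m = d j m" if ij: "i \<in> I" "j \<in> I" and m: "m \<in> N i" "m \<in> N j" for i j m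
    proof -
      have step: "d l m = d i m" if il: "(i, l) \<in> r" and m: "m \<in> N i" for i l
      proof -
        have "Comp C (X i) (X l) Z (d l) (t i l) = d i"
          using bspec[OF conjunct2[OF conjunct2[OF d[unfolded is_cocone_def]]] il] by simp
        then have "compose (N i) (d l) (\<lambda>m\<in>N i. m) = d i" by (simp add: C_def X_def t_def)
        from fun_cong[OF this, of m] show ?thesis using m by (simp add: compose_def)
      qed
      obtain l where "(i, l) \<in> r" "(j, l) \<in> r" using dir[OF ij] by auto
      then show ?thesis using step[of i l] step[of j l] m by simp
    qed
    define s where "s m = (SOME i. i \<in> I \<and> m \<in> N i)" for m
    have s: "s m \<in> I \<and> m \<in> N (s m)" if "m \<in> carrier M" for m
    proof -
      have "\<exists>i. i \<in> I \<and> m \<in> N i" using cover[of "{m}"] that by auto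
      then show ?thesis unfolding s_def by (rule someI_ex)
    qed
    define h where "h = (\<lambda>m\<in>carrier M. d (s m) m)"
    have hd: "h m = d i m" if "i \<in> I" "m \<in> N i" for i m
      using dc[of "s m" i m] s[OF mem[OF that]] that mem[OF that] by (simp add: h_def)
    have h: "h \<in> rmod_hom R M Z"
    proof (rule rmod_homI)
      fix m assume m: "m \<in> carrier M"
      show "h m \<in> carrier Z"
        using rmod_hom_closed[OF dh, of "s m" m] s[OF m] m by (simp add: h_def X_def)
    next
      fix m assume "m \<notin> carrier M" then show "h m = undefined" by (simp add: h_def)
    next
      fix m n assume m: "m \<in> carrier M" and n: "n \<in> carrier M"
      obtain i where i: "i \<in> I" "m \<in> N i" "n \<in> N i" using cover[of "{m, n}"] m n by auto
      then have "m \<oplus>\<^bsub>M\<^esub> n \<in> N i" using N[OF i(1)] by (simp add: is_submodule_def)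
      then show "h (m \<oplus>\<^bsub>M\<^esub> n) = h m \<oplus>\<^bsub>Z\<^esub> h n"
        using rmod_hom_add[OF dh[OF i(1)], of m n] i by (simp add: hd X_def)
    next
      fix a m assume a: "a \<in> carrier R" and m: "m \<in> carrier M"
      obtain i where i: "i \<in> I" "m \<in> N i" using cover[of "{m}"] m by auto
      then have "a \<odot>\<^bsub>M\<^esub> m \<in> N i" using N[OF i(1)] a by (simp add: is_submodule_def)
      then show "h (a \<odot>\<^bsub>M\<^esub> m) = a \<odot>\<^bsub>Z\<^esub> h m"
        using rmod_hom_act[OF dh[OF i(1)] a, of m] i by (simp add: hd X_def)
    qed
    have hc: "compose (N i) h (\<lambda>m\<in>N i. m) = d i" if "i \<in> I" for i
      using rmod_hom_undefined[OF dh[OF that]] hd[OF that]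
      by (intro ext) (auto simp: compose_def restrict_def X_def)
    show "\<exists>!h. h \<in> arr C M Z \<and> (\<forall>i\<in>I. Comp C (X i) M Z h (\<lambda>m\<in>N i. m) = d i)"
    proof (rule ex1I)
      show "h \<in> arr C M Z \<and> (\<forall>i\<in>I. Comp C (X i) M Z h (\<lambda>m\<in>N i. m) = d i)"
        using h hc by (simp add: C_def X_def)
      fix h' assume "h' \<in> arr C M Z \<and> (\<forall>i\<in>I. Comp C (X i) M Z h' (\<lambda>m\<in>N i. m) = d i)"
      then have h': "h' \<in> rmod_hom R M Z" and eq: "\<And>i. i \<in> I \<Longrightarrow> compose (N i) h' (\<lambda>m\<in>N i. m) = d i"
        by (simp_all add: C_def X_def)
      show "h' = h"
      proof (rule rmod_hom_eqI[OF h' h])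
        fix m assume m: "m \<in> carrier M"
        then have "h' m = d (s m) m"
          using fun_cong[OF eq, of "s m" m] s[OF m] by (simp add: compose_def)
        then show "h' m = h m" using m by (simp add: h_def)
      qed
    qed
  qed (rule cone)
qed

text \<open>
  The finitely generated submodules of \<open>M\<close>, indexed by finite generating sets.  Indexing by sets of generators
  and not by submodules keeps the index set small and makes the order antisymmetric through
  the bijectivity of the indexing.
\<close>
lemma ex_fg_directed_system:
  fixes R :: "('u, 'y) ring_scheme" and M :: "('u, 'u) module"
  assumes U: "small_universe U" and M: "M \<in> Obj (Mod R \<gamma> U)"
  obtains I :: "'u set" and r and D
  where "I \<in> U" "\<And>i. i \<in> I \<Longrightarrow> finite (D i) \<and> D i \<subseteq> carrier M"
    "\<And>m. m \<in> carrier M \<Longrightarrow> \<exists>i\<in>I. m \<in> D i"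
    "directed_system (Mod R \<gamma> U) I r (\<lambda>i. M\<lparr>carrier := span R M (D i)\<rparr>) (\<lambda>i j. \<lambda>m\<in>span R M (D i). m)"
    "is_direct_limit (Mod R \<gamma> U) I r (\<lambda>i. M\<lparr>carrier := span R M (D i)\<rparr>) (\<lambda>i j. \<lambda>m\<in>span R M (D i). m)
       M (\<lambda>i. \<lambda>m\<in>span R M (D i). m)"
proof -
  interpret M: right_module R M using M by (simp add: Mod_Obj)
  have "carrier M \<in> U" using M by (simp add: Mod_Obj)
  from ex_small_index_of_finite_subsets[OF U this]
  obtain I D where I: "I \<in> U" and D: "bij_betw D I {A. finite A \<and> A \<subseteq> carrier M}"
    by auto
  have fin: "finite (D i) \<and> D i \<subseteq> carrier M" if "i \<in> I" for i
    using bij_betw_apply[OF D that] by simp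
  have onto: "\<exists>i\<in>I. D i = A" if A: "finite A" "A \<subseteq> carrier M" for A
  proof -
    have "A \<in> D ` I" unfolding bij_betw_imp_surj_on[OF D] using A by simp
    then show ?thesis by (auto simp: image_iff)
  qed
  define r where "r = {(i, j). i \<in> I \<and> j \<in> I \<and> D i \<subseteq> D j}"
  have po: "partial_order_on I r"
    unfolding partial_order_on_def preorder_on_def
  proof (intro conjI)
    show "refl_on I r" by (auto simp: refl_on_def r_def)
    show "trans r" by (auto simp: trans_def r_def)
    show "antisym r" using inj_onD[OF bij_betw_imp_inj_on[OF D]] by (auto simp: antisym_def r_def)
  qed (auto simp: r_def)
  have ne: "I \<noteq> {}" using onto[of "{}"] by auto
  have dir: "\<exists>l\<in>I. (i, l) \<in> r \<and> (j, l) \<in> r" if ij: "i \<in> I" "j \<in> I" for i j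
  proof -
    obtain l where "l \<in> I" "D l = D i \<union> D j"
      using onto[of "D i \<union> D j"] fin[OF ij(1)] fin[OF ij(2)] by auto
    then show ?thesis using ij by (auto simp: r_def)
  qed
  have cover: "\<exists>i\<in>I. A \<subseteq> span R M (D i)" if "finite A" "A \<subseteq> carrier M" for A
    using onto[OF that] by (auto intro: span_base)
  have mono: "span R M (D i) \<subseteq> span R M (D j)" if "(i, j) \<in> r" for i j
    using that by (intro span_mono) (simp add: r_def)
  have sub: "is_submodule R M (span R M (D i))" if "i \<in> I" for i
    using fin[OF that] by (intro M.span_is_submodule) simp
  note lim = is_direct_limit_of_submodules[OF U M sub ne po mono cover dir]
  show ?thesis
  proof (rule that[OF I fin _ lim])
    show "\<exists>i\<in>I. m \<in> D i" if "m \<in> carrier M" for m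
      using onto[of "{m}"] that by auto
  qed
qed

section \<open>Functors on right modules and the orbit arrows\<close>

locale right_exact_limit_functor =
  fixes k :: "('k, 'z) ring_scheme"
    and R :: "('u, 'y) ring_scheme"
    and \<gamma> :: "'k \<Rightarrow> 'u"
    and U :: "'u set set"
    and A :: "('k, 'o, 'u) cat"
    and F :: "(('u, 'u) module, 'u \<Rightarrow> 'u, 'o, 'u) func"
  assumes U: "small_universe U"
    and algebra: "k_algebra k R \<gamma>"
    and small_ring: "carrier R \<in> U"
    and abelian: "abelian_category A"
    and F: "F \<in> Bk k U (Mod R \<gamma> U) A"
begin

sublocale A: abelian_category A by (rule abelian)

sublocale R: ring R using algebra by (simp add: k_algebra_def)

abbreviation C where "C \<equiv> Mod R \<gamma> U"

abbreviation RR where "RR \<equiv> regular_module R"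

abbreviation FR where "FR \<equiv> FObj F RR"

definition \<rho> where "\<rho> x = FMap F RR RR (left_mult R x)"

definition orbit_arrow where "orbit_arrow M m = FMap F RR M (orbit_map R M m)"

lemma C_module: "M \<in> Obj C \<Longrightarrow> right_module R M"
  by (simp add: Mod_Obj)

lemma RR_simps [simp]:
  "carrier RR = carrier R" "zero RR = zero R" "add RR = add R" "smult RR r x = x \<otimes>\<^bsub>R\<^esub> r"
  by (simp_all add: regular_module_def)

lemma RR_Obj: "RR \<in> Obj C"
  by (simp add: Mod_Obj regular_module_right_module R.ring_axioms small_ring)

lemma F_functor: "is_functor C A F" and F_linear: "linear_functor k C A F"
  and F_right_exact: "right_exact C A F" and F_limits: "preserves_direct_limits U C A F"
  using F by (simp_all add: Bk_def linear_functor_def)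

lemma F_obj: "M \<in> Obj C \<Longrightarrow> FObj F M \<in> Obj A"
  using F_functor by (simp add: is_functor_def)

lemma F_map:
  "\<lbrakk> M \<in> Obj C; N \<in> Obj C; f \<in> rmod_hom R M N \<rbrakk> \<Longrightarrow> FMap F M N f \<in> arr A (FObj F M) (FObj F N)"
  using F_functor by (simp add: is_functor_def)

lemma F_id: "M \<in> Obj C \<Longrightarrow> FMap F M M (\<lambda>m\<in>carrier M. m) = Idt A (FObj F M)"
  using F_functor by (simp add: is_functor_def)

lemma F_comp:
  "\<lbrakk> M \<in> Obj C; N \<in> Obj C; P \<in> Obj C; f \<in> rmod_hom R M N; g \<in> rmod_hom R N P \<rbrakk>
    \<Longrightarrow> FMap F M P (compose (carrier M) g f) =
        Comp A (FObj F M) (FObj F N) (FObj F P) (FMap F N P g) (FMap F M N f)"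
  using F_functor by (simp add: is_functor_def)

lemma F_add:
  "\<lbrakk> M \<in> Obj C; N \<in> Obj C; f \<in> rmod_hom R M N; g \<in> rmod_hom R M N \<rbrakk>
    \<Longrightarrow> FMap F M N (\<lambda>m\<in>carrier M. f m \<oplus>\<^bsub>N\<^esub> g m) =
        FMap F M N f \<oplus>\<^bsub>Hom A (FObj F M) (FObj F N)\<^esub> FMap F M N g"
  using F_linear by (simp add: linear_functor_def)

lemma F_smult:
  "\<lbrakk> M \<in> Obj C; N \<in> Obj C; a \<in> carrier k; f \<in> rmod_hom R M N \<rbrakk>
    \<Longrightarrow> FMap F M N (\<lambda>m\<in>carrier M. \<gamma> a \<odot>\<^bsub>N\<^esub> f m) =
        a \<odot>\<^bsub>Hom A (FObj F M) (FObj F N)\<^esub> FMap F M N f"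
  using F_linear by (simp add: linear_functor_def)

lemma orbit_arrow_closed: "\<lbrakk> M \<in> Obj C; m \<in> carrier M \<rbrakk> \<Longrightarrow> orbit_arrow M m \<in> arr A FR (FObj F M)"
  unfolding orbit_arrow_def by (intro F_map RR_Obj orbit_map_rmod_hom C_module)

lemma orbit_arrow_natural:
  assumes M: "M \<in> Obj C" and N: "N \<in> Obj C" and f: "f \<in> rmod_hom R M N" and m: "m \<in> carrier M"
  shows "Comp A FR (FObj F M) (FObj F N) (FMap F M N f) (orbit_arrow M m) = orbit_arrow N (f m)"
proof -
  interpret M: right_module R M by (rule C_module[OF M])
  have "compose (carrier RR) f (orbit_map R M m) = orbit_map R N (f m)"
    using rmod_hom_act[OF f _ m] by (intro ext) (simp add: compose_def restrict_def orbit_map_def)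
  then show ?thesis
    using F_comp[OF RR_Obj M N orbit_map_rmod_hom[OF C_module[OF M] m] f] by (simp add: orbit_arrow_def)
qed

lemma orbit_arrow_add:
  assumes M: "M \<in> Obj C" and m: "m \<in> carrier M" and n: "n \<in> carrier M"
  shows "orbit_arrow M (m \<oplus>\<^bsub>M\<^esub> n) = orbit_arrow M m \<oplus>\<^bsub>Hom A FR (FObj F M)\<^esub> orbit_arrow M n"
proof -
  interpret M: right_module R M by (rule C_module[OF M])
  have "orbit_map R M (m \<oplus>\<^bsub>M\<^esub> n) =
      (\<lambda>r\<in>carrier RR. orbit_map R M m r \<oplus>\<^bsub>M\<^esub> orbit_map R M n r)"
    using m n by (intro ext) (simp add: orbit_map_def M.act_add_mod)
  then show ?thesis
    using F_add[OF RR_Obj M orbit_map_rmod_hom[OF C_module[OF M] m] orbit_map_rmod_hom[OF C_module[OF M] n]]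
    by (simp add: orbit_arrow_def)
qed

lemma orbit_arrow_zero:
  assumes M: "M \<in> Obj C"
  shows "orbit_arrow M \<zero>\<^bsub>M\<^esub> = \<zero>\<^bsub>Hom A FR (FObj F M)\<^esub>"
proof -
  interpret M: right_module R M by (rule C_module[OF M])
  show ?thesis
    using orbit_arrow_add[OF M M.M.zero_closed M.M.zero_closed]
    by (intro A.Hom_idem_zero F_obj RR_Obj M orbit_arrow_closed) simp_all
qed

lemma orbit_arrow_regular: "orbit_arrow RR r = \<rho> r"
  by (simp add: orbit_arrow_def \<rho>_def orbit_map_regular)

lemma orbit_arrow_act:
  assumes M: "M \<in> Obj C" and m: "m \<in> carrier M" and r: "r \<in> carrier R"
  shows "orbit_arrow M (r \<odot>\<^bsub>M\<^esub> m) = Comp A FR FR (FObj F M) (orbit_arrow M m) (\<rho> r)"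
  using orbit_arrow_natural[OF RR_Obj M orbit_map_rmod_hom[OF C_module[OF M] m], of r] r
  by (simp add: orbit_arrow_regular orbit_arrow_def[of M m] orbit_map_def[of R M m])

lemma orbit_arrow_one: "orbit_arrow RR \<one>\<^bsub>R\<^esub> = Idt A FR"
proof -
  have "left_mult R \<one>\<^bsub>R\<^esub> = (\<lambda>r\<in>carrier RR. r)"
    by (intro ext) (simp add: left_mult_def)
  then show ?thesis using F_id[OF RR_Obj] by (simp add: orbit_arrow_regular \<rho>_def)
qed

text \<open>
  The endomorphism \<open>\<rho> x\<close> is the orbit arrow of \<open>x \<in> R\<close>, so multiplicativity and additivity of \<open>\<rho>\<close> are instances of
  the rules for orbit arrows.
\<close>
lemma regular_ring_left_module: "(FR, \<rho>) \<in> left_modules_in k R \<gamma> A"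
proof -
  note O = F_obj[OF RR_Obj]
  have cl: "\<rho> x \<in> arr A FR FR" if "x \<in> carrier R" for x
    using orbit_arrow_closed[OF RR_Obj, of x] that by (simp add: orbit_arrow_regular)
  have "\<rho> \<in> ring_hom R (End_ring A FR)"
  proof (rule ring_hom_memI)
    fix x y assume x: "x \<in> carrier R" and y: "y \<in> carrier R"
    show "\<rho> x \<in> carrier (End_ring A FR)" using cl[OF x] by (simp add: End_ring_def)
    show "\<rho> (x \<otimes>\<^bsub>R\<^esub> y) = \<rho> x \<otimes>\<^bsub>End_ring A FR\<^esub> \<rho> y"
      using orbit_arrow_act[OF RR_Obj, of x y] x y
      by (simp add: orbit_arrow_regular End_ring_def)
    show "\<rho> (x \<oplus>\<^bsub>R\<^esub> y) = \<rho> x \<oplus>\<^bsub>End_ring A FR\<^esub> \<rho> y"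
      using orbit_arrow_add[OF RR_Obj, of x y] x y
      by (simp add: orbit_arrow_regular End_ring_def)
  next
    show "\<rho> \<one>\<^bsub>R\<^esub> = \<one>\<^bsub>End_ring A FR\<^esub>" using orbit_arrow_one by (simp add: orbit_arrow_regular End_ring_def)
  qed
  moreover have "\<rho> (\<gamma> a) = a \<odot>\<^bsub>Hom A FR FR\<^esub> Idt A FR" if a: "a \<in> carrier k" for a
  proof -
    have \<gamma>: "\<gamma> a \<in> carrier R" "\<And>x. x \<in> carrier R \<Longrightarrow> \<gamma> a \<otimes>\<^bsub>R\<^esub> x = x \<otimes>\<^bsub>R\<^esub> \<gamma> a"
      using algebra a by (auto simp: k_algebra_def intro: ring_hom_closed)
    interpret RR: right_module R RR by (rule C_module[OF RR_Obj])
    have id: "(\<lambda>r\<in>carrier RR. r) \<in> rmod_hom R RR RR"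
      by (rule rmod_homI) (auto simp del: RR_simps intro: RR.act_closed)
    have "left_mult R (\<gamma> a) = (\<lambda>r\<in>carrier RR. \<gamma> a \<odot>\<^bsub>RR\<^esub> (\<lambda>r\<in>carrier RR. r) r)"
      by (intro ext) (simp add: left_mult_def \<gamma>)
    then have "\<rho> (\<gamma> a) = FMap F RR RR (\<lambda>r\<in>carrier RR. \<gamma> a \<odot>\<^bsub>RR\<^esub> (\<lambda>r\<in>carrier RR. r) r)"
      unfolding \<rho>_def by (rule arg_cong)
    also have "\<dots> = a \<odot>\<^bsub>Hom A FR FR\<^esub> FMap F RR RR (\<lambda>r\<in>carrier RR. r)"
      by (rule F_smult[OF RR_Obj RR_Obj a id])
    finally show ?thesis unfolding F_id[OF RR_Obj] .
  qed
  ultimately show ?thesis using O by (simp add: left_modules_in_def)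
qed

abbreviation HomF where "HomF N \<equiv> FObj (Hom_functor A (FR, \<rho>)) N"

lemma HomF_simps:
  "carrier (HomF N) = arr A FR N" "add (HomF N) = add (Hom A FR N)"
  "\<alpha> \<in> arr A FR N \<Longrightarrow> FMap (Hom_functor A (FR, \<rho>)) N N' \<beta> \<alpha> = Comp A FR N N' \<beta> \<alpha>"
  "smult (HomF N) r \<alpha> = Comp A FR FR N \<alpha> (\<rho> r)"
  by (simp_all add: Hom_functor_def)

text \<open>This becomes the bijection of the adjunction between \<open>F\<close> and \<open>Hom\<^sub>A (FR, -)\<close>.\<close>
definition transpose where
  "transpose M N b = (\<lambda>m\<in>carrier M. Comp A FR (FObj F M) N b (orbit_arrow M m))"

lemma transpose_rmod_hom:
  assumes M: "M \<in> Obj C" and N: "N \<in> Obj A" and b: "b \<in> arr A (FObj F M) N"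
  shows "transpose M N b \<in> rmod_hom R M (HomF N)"
proof -
  interpret M: right_module R M by (rule C_module[OF M])
  note o = F_obj[OF RR_Obj] F_obj[OF M]
  have \<rho>: "r \<in> carrier R \<Longrightarrow> \<rho> r \<in> arr A FR FR" for r
    using orbit_arrow_closed[OF RR_Obj, of r] by (simp add: orbit_arrow_regular)
  show ?thesis
  proof (rule rmod_homI)
    fix m assume m: "m \<in> carrier M"
    then show "transpose M N b m \<in> carrier (HomF N)"
      using A.Comp_closed[OF o N orbit_arrow_closed[OF M m] b] by (simp add: transpose_def HomF_simps)
  next
    fix m n assume m: "m \<in> carrier M" and n: "n \<in> carrier M"
    then show "transpose M N b (m \<oplus>\<^bsub>M\<^esub> n) = transpose M N b m \<oplus>\<^bsub>HomF N\<^esub> transpose M N b n"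
      using A.Comp_add_right[OF o N orbit_arrow_closed[OF M m] orbit_arrow_closed[OF M n] b]
      by (simp add: transpose_def HomF_simps orbit_arrow_add[OF M])
  next
    fix r m assume r: "r \<in> carrier R" and m: "m \<in> carrier M"
    then show "transpose M N b (r \<odot>\<^bsub>M\<^esub> m) = r \<odot>\<^bsub>HomF N\<^esub> transpose M N b m"
      using A.Comp_assoc[OF o(1,1,2) N \<rho>[OF r] orbit_arrow_closed[OF M m] b]
      by (simp add: transpose_def HomF_simps orbit_arrow_act[OF M] M.act_closed)
  qed (simp add: transpose_def)
qed

end

section \<open>Induction over right modules\<close>

lemma span_object:
  assumes U: "small_universe U" and M: "M \<in> Obj (Mod R \<gamma> U)" and S: "S \<subseteq> carrier M"
  shows "M\<lparr>carrier := span R M S\<rparr> \<in> Obj (Mod R \<gamma> U)"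
proof -
  interpret M: right_module R M using M by (simp add: Mod_Obj)
  note sub = M.span_is_submodule[OF S]
  have "carrier M \<in> U" using M by (simp add: Mod_Obj)
  then have "span R M S \<in> U"
    using sub by (intro small_subset[OF U, of "carrier M" "span R M S"]) (simp_all add: is_submodule_def)
  then show ?thesis using M.submodule_right_module[OF sub] by (simp add: Mod_Obj)
qed

text \<open>
  Finitely generated modules come from \<open>R\<close> by adding one generator at a time: the submodule generated by
  \<open>insert x S\<close> is the image of (span of \<open>S\<close>) \<open>\<oplus> R\<close>.  Every module is a direct limit of such submodules.  In the
  limit step the structure maps may be assumed jointly surjective.
\<close>
lemma module_induct [consumes 3, case_names regular pair image limit]:
  fixes R :: "('u, 'y) ring_scheme" and \<gamma> :: "'k \<Rightarrow> 'u" and U :: "'u set set"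
  assumes U: "small_universe U" and R: "carrier R \<in> U" and M: "M \<in> Obj (Mod R \<gamma> U)"
    and regular: "Q (regular_module R)"
    and pair: "\<And>e M N. \<lbrakk> inj e; M \<in> Obj (Mod R \<gamma> U); N \<in> Obj (Mod R \<gamma> U);
        pair_module e M N \<in> Obj (Mod R \<gamma> U); Q M; Q N \<rbrakk> \<Longrightarrow> Q (pair_module e M N)"
    and image: "\<And>M N f. \<lbrakk> M \<in> Obj (Mod R \<gamma> U); N \<in> Obj (Mod R \<gamma> U); f \<in> rmod_hom R M N;
        f ` carrier M = carrier N; Q M \<rbrakk> \<Longrightarrow> Q N"
    and limit: "\<And>(I :: 'u set) r X t M c. \<lbrakk> I \<in> U; directed_system (Mod R \<gamma> U) I r X t;
        is_direct_limit (Mod R \<gamma> U) I r X t M c; \<And>m. m \<in> carrier M \<Longrightarrow> \<exists>i\<in>I. m \<in> c i ` carrier (X i);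
        \<And>i. i \<in> I \<Longrightarrow> Q (X i) \<rbrakk> \<Longrightarrow> Q M"
  shows "Q M"
proof -
  interpret M: right_module R M using M by (simp add: Mod_Obj)
  obtain e :: "'u \<times> 'u \<Rightarrow> 'u" where e: "inj e" using ex_pair_code[OF U] by (elim exE)
  have RO: "regular_module R \<in> Obj (Mod R \<gamma> U)"
    using R regular_module_right_module[OF M.R.ring_axioms] by (simp add: Mod_Obj regular_module_def)
  have carR: "carrier (regular_module R) = carrier R" by (simp add: regular_module_def)
  have fg: "Q (M\<lparr>carrier := span R M S\<rparr>)" if "finite S" "S \<subseteq> carrier M" for S
    using that
  proof (induction S)
    case empty
    \<comment> \<open>the zero submodule is the image of \<open>R\<close> under the orbit map of zero\<close>
    let ?N = "M\<lparr>carrier := span R M {}\<rparr>"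
    have NO: "?N \<in> Obj (Mod R \<gamma> U)" using span_object[OF U M, of "{}"] by simp
    interpret N: right_module R ?N using NO by (simp add: Mod_Obj)
    have z: "\<zero>\<^bsub>M\<^esub> \<in> carrier ?N" by (simp add: M.span_empty)
    have "orbit_map R ?N \<zero>\<^bsub>M\<^esub> ` carrier (regular_module R) = carrier ?N"
      by (auto simp: carR orbit_map_def M.span_empty M.act_zero image_iff intro!: bexI[of _ "\<zero>\<^bsub>R\<^esub>"])
    then show ?case
      using image[OF RO NO orbit_map_rmod_hom[OF N.right_module_axioms z] _ regular] by simp
  next
    case (insert x S)
    let ?N = "M\<lparr>carrier := span R M S\<rparr>" and ?N' = "M\<lparr>carrier := span R M (insert x S)\<rparr>"
    have S: "S \<subseteq> carrier M" and x: "x \<in> carrier M" using insert.prems by auto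
    have NO: "?N \<in> Obj (Mod R \<gamma> U)" by (rule span_object[OF U M S])
    have NO': "?N' \<in> Obj (Mod R \<gamma> U)" by (rule span_object[OF U M insert.prems])
    have rN: "right_module R ?N" and rR: "right_module R (regular_module R)"
      using NO RO by (simp_all add: Mod_Obj)
    define P where "P = pair_module e ?N (regular_module R)"
    have rP: "right_module R P" unfolding P_def by (rule pair_module_right_module[OF rN rR e])
    interpret P: right_module R P by (rule rP)
    have cP: "carrier P = e ` (span R M S \<times> carrier R)"
      by (simp add: P_def pair_module_def carR)
    have PO: "P \<in> Obj (Mod R \<gamma> U)"
      using rP small_coded_Times[OF U _ R, of "span R M S" e] NO by (simp add: Mod_Obj cP)
    have QP: "Q P" unfolding P_def
      using pair[OF e NO RO _ insert.IH[OF S] regular] PO by (simp add: P_def)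
    obtain i j p q where "i \<in> rmod_hom R ?N P" "j \<in> rmod_hom R (regular_module R) P"
        and p: "p \<in> rmod_hom R P ?N" and q: "q \<in> rmod_hom R P (regular_module R)"
        and "\<And>z. z \<in> carrier P \<Longrightarrow> i (p z) \<oplus>\<^bsub>P\<^esub> j (q z) = z"
        and pq: "\<And>m n. \<lbrakk> m \<in> carrier ?N; n \<in> carrier (regular_module R) \<rbrakk> \<Longrightarrow> p (e (m, n)) = m \<and> q (e (m, n)) = n"
      by (rule pair_module_identity[OF rN rR e P_def]) blast
    have memN: "n \<in> carrier M" if "n \<in> span R M S" for n
      using M.span_is_submodule[OF S] that by (auto simp: is_submodule_def)
    have pc: "p z \<in> span R M S" "p z \<in> carrier M" "q z \<in> carrier R" if "z \<in> carrier P" for z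
      using rmod_hom_closed[OF p that] rmod_hom_closed[OF q that] memN by (simp_all add: carR)
    have span': "span R M (insert x S) = {n \<oplus>\<^bsub>M\<^esub> r \<odot>\<^bsub>M\<^esub> x | n r. n \<in> span R M S \<and> r \<in> carrier R}"
      by (rule M.span_insert[OF S x])
    define f where "f = (\<lambda>z\<in>carrier P. p z \<oplus>\<^bsub>M\<^esub> q z \<odot>\<^bsub>M\<^esub> x)"
    have f: "f \<in> rmod_hom R P ?N'"
    proof (rule rmod_homI)
      fix z assume z: "z \<in> carrier P"
      then show "f z \<in> carrier ?N'" using pc[OF z] by (auto simp: f_def span')
    next
      fix z assume "z \<notin> carrier P" then show "f z = undefined" by (simp add: f_def)
    next
      fix z w assume z: "z \<in> carrier P" and w: "w \<in> carrier P"
      then show "f (z \<oplus>\<^bsub>P\<^esub> w) = f z \<oplus>\<^bsub>?N'\<^esub> f w"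
        using pc[OF z] pc[OF w] rmod_hom_add[OF p z w] rmod_hom_add[OF q z w] x
        by (simp add: f_def regular_module_def M.act_add_ring M.act_closed M.M.a_ac)
    next
      fix r z assume r: "r \<in> carrier R" and z: "z \<in> carrier P"
      then show "f (r \<odot>\<^bsub>P\<^esub> z) = r \<odot>\<^bsub>?N'\<^esub> f z"
        using pc[OF z] rmod_hom_act[OF p r z] rmod_hom_act[OF q r z] x
        by (simp add: f_def regular_module_def P.act_closed M.act_add_mod M.act_closed M.act_assoc)
    qed
    have "f ` carrier P = carrier ?N'"
    proof
      show "f ` carrier P \<subseteq> carrier ?N'" using rmod_hom_closed[OF f] by auto
      show "carrier ?N' \<subseteq> f ` carrier P"
      proof
        fix y assume "y \<in> carrier ?N'"
        then obtain n r where y: "y = n \<oplus>\<^bsub>M\<^esub> r \<odot>\<^bsub>M\<^esub> x" "n \<in> span R M S" "r \<in> carrier R"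
          by (auto simp: span')
        then have "e (n, r) \<in> carrier P" by (simp add: cP)
        moreover have "y = f (e (n, r))" using pq[of n r] y calculation by (simp add: f_def carR)
        ultimately show "y \<in> f ` carrier P" by (intro image_eqI)
      qed
    qed
    from image[OF PO NO' f this QP] show ?case .
  qed
  obtain I :: "'u set" and r and D where I: "I \<in> U"
      and D: "\<And>i. i \<in> I \<Longrightarrow> finite (D i) \<and> D i \<subseteq> carrier M"
      and cover: "\<And>m. m \<in> carrier M \<Longrightarrow> \<exists>i\<in>I. m \<in> D i"
      and sys: "directed_system (Mod R \<gamma> U) I r (\<lambda>i. M\<lparr>carrier := span R M (D i)\<rparr>)
        (\<lambda>i j. \<lambda>m\<in>span R M (D i). m)"
      and lim: "is_direct_limit (Mod R \<gamma> U) I r (\<lambda>i. M\<lparr>carrier := span R M (D i)\<rparr>)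
        (\<lambda>i j. \<lambda>m\<in>span R M (D i). m) M (\<lambda>i. \<lambda>m\<in>span R M (D i). m)"
    by (rule ex_fg_directed_system[OF U M]) blast
  show ?thesis
  proof (rule limit[OF I sys lim])
    fix m assume "m \<in> carrier M"
    then obtain i where i: "i \<in> I" "m \<in> D i" using cover by auto
    then have "m \<in> span R M (D i)" by (intro span_base)
    then show "\<exists>i\<in>I. m \<in> (\<lambda>m\<in>span R M (D i). m) ` carrier (M\<lparr>carrier := span R M (D i)\<rparr>)"
      using i(1) by (auto simp: image_iff)
  next
    fix i assume "i \<in> I" then show "Q (M\<lparr>carrier := span R M (D i)\<rparr>)" using fg D by simp
  qed
qed

section \<open>Arrows out of the values of the functor\<close>

context right_exact_limit_functor
begin

text \<open>In other words, the orbit arrows \<open>FR \<rightarrow> FM\<close> are jointly epic.\<close>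
definition determined where
  "determined M \<longleftrightarrow> M \<in> Obj C \<and> (\<forall>N\<in>Obj A. inj_on (transpose M N) (arr A (FObj F M) N))"

text \<open>In other words, \<open>FM\<close> represents the functor \<open>N \<mapsto> Hom\<^sub>R (M, Hom\<^sub>A (FR, N))\<close> by means of the orbit arrows.\<close>
definition representable where
  "representable M \<longleftrightarrow> determined M \<and>
    (\<forall>N\<in>Obj A. rmod_hom R M (HomF N) \<subseteq> transpose M N ` arr A (FObj F M) N)"

lemma determinedI:
  assumes "M \<in> Obj C"
    "\<And>N b b'. \<lbrakk> N \<in> Obj A; b \<in> arr A (FObj F M) N; b' \<in> arr A (FObj F M) N;
      \<And>m. m \<in> carrier M \<Longrightarrow> Comp A FR (FObj F M) N b (orbit_arrow M m) = Comp A FR (FObj F M) N b' (orbit_arrow M m) \<rbrakk>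
      \<Longrightarrow> b = b'"
  shows "determined M"
  unfolding determined_def
proof (intro conjI ballI inj_onI)
  fix N b b' assume N: "N \<in> Obj A" and b: "b \<in> arr A (FObj F M) N" and b': "b' \<in> arr A (FObj F M) N"
    and eq: "transpose M N b = transpose M N b'"
  show "b = b'"
  proof (rule assms(2)[OF N b b'])
    fix m assume "m \<in> carrier M"
    then show "Comp A FR (FObj F M) N b (orbit_arrow M m) = Comp A FR (FObj F M) N b' (orbit_arrow M m)"
      using fun_cong[OF eq, of m] by (simp add: transpose_def)
  qed
qed (rule assms(1))

lemma determinedD:
  assumes "determined M" "N \<in> Obj A" "b \<in> arr A (FObj F M) N" "b' \<in> arr A (FObj F M) N"
    "\<And>m. m \<in> carrier M \<Longrightarrow> Comp A FR (FObj F M) N b (orbit_arrow M m) = Comp A FR (FObj F M) N b' (orbit_arrow M m)"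
  shows "b = b'"
proof -
  have "inj_on (transpose M N) (arr A (FObj F M) N)" using assms(1,2) by (simp add: determined_def)
  moreover have "transpose M N b = transpose M N b'"
    unfolding transpose_def by (rule restrict_ext) (rule assms(5))
  ultimately show ?thesis using assms(3,4) by (rule inj_onD)
qed

lemma representableI:
  assumes "determined M"
    "\<And>N h. \<lbrakk> N \<in> Obj A; h \<in> rmod_hom R M (HomF N) \<rbrakk>
      \<Longrightarrow> \<exists>b\<in>arr A (FObj F M) N. \<forall>m\<in>carrier M. Comp A FR (FObj F M) N b (orbit_arrow M m) = h m"
  shows "representable M"
  unfolding representable_def
proof (intro conjI ballI subsetI)
  fix N h assume N: "N \<in> Obj A" and h: "h \<in> rmod_hom R M (HomF N)"
  obtain b where b: "b \<in> arr A (FObj F M) N"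
      "\<forall>m\<in>carrier M. Comp A FR (FObj F M) N b (orbit_arrow M m) = h m"
    using assms(2)[OF N h] by (elim bexE)
  have "M \<in> Obj C" using assms(1) by (simp add: determined_def)
  then have "h = transpose M N b"
    by (rule rmod_hom_eqI[OF h transpose_rmod_hom[OF _ N b(1)]]) (simp add: transpose_def b(2))
  then show "h \<in> transpose M N ` arr A (FObj F M) N" using b(1) by (rule image_eqI)
qed (rule assms(1))

lemma representableD:
  assumes "representable M" "N \<in> Obj A" "h \<in> rmod_hom R M (HomF N)"
  obtains b where "b \<in> arr A (FObj F M) N"
    "\<And>m. m \<in> carrier M \<Longrightarrow> Comp A FR (FObj F M) N b (orbit_arrow M m) = h m"
proof -
  have "h \<in> transpose M N ` arr A (FObj F M) N" using assms by (auto simp: representable_def)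
  then obtain b where b: "h = transpose M N b" "b \<in> arr A (FObj F M) N" by (rule imageE)
  show ?thesis by (rule that[OF b(2)]) (simp add: b(1) transpose_def)
qed

lemma Comp_F_orbit_arrow:
  assumes M: "M \<in> Obj C" and M': "M' \<in> Obj C" and f: "f \<in> rmod_hom R M M'"
    and N: "N \<in> Obj A" and b: "b \<in> arr A (FObj F M') N" and m: "m \<in> carrier M"
  shows "Comp A FR (FObj F M) N (Comp A (FObj F M) (FObj F M') N b (FMap F M M' f)) (orbit_arrow M m) =
    Comp A FR (FObj F M') N b (orbit_arrow M' (f m))"
  using A.Comp_assoc[OF F_obj[OF RR_Obj] F_obj[OF M] F_obj[OF M'] N orbit_arrow_closed[OF M m] F_map[OF M M' f] b]
    orbit_arrow_natural[OF M M' f m] by simp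

lemma determined_regular: "determined RR"
proof (rule determinedI[OF RR_Obj])
  fix N b b' assume N: "N \<in> Obj A" and b: "b \<in> arr A FR N" and b': "b' \<in> arr A FR N"
    and eq: "\<And>m. m \<in> carrier RR \<Longrightarrow> Comp A FR FR N b (orbit_arrow RR m) = Comp A FR FR N b' (orbit_arrow RR m)"
  show "b = b'"
    using eq[of "\<one>\<^bsub>R\<^esub>"] A.Comp_Idt[OF F_obj[OF RR_Obj] N b] A.Comp_Idt[OF F_obj[OF RR_Obj] N b']
    by (simp add: orbit_arrow_one)
qed

text \<open>A homomorphism \<open>h : R \<rightarrow> Hom\<^sub>A (FR, N)\<close> is determined by \<open>h 1\<close>, which is the required arrow.\<close>
lemma representable_regular: "representable RR"
proof (rule representableI[OF determined_regular])
  fix N h assume N: "N \<in> Obj A" and h: "h \<in> rmod_hom R RR (HomF N)"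
  have "Comp A FR FR N (h \<one>\<^bsub>R\<^esub>) (orbit_arrow RR r) = h r" if "r \<in> carrier R" for r
    using rmod_hom_act[OF h that, of "\<one>\<^bsub>R\<^esub>"] that by (simp add: orbit_arrow_regular HomF_simps)
  moreover have "h \<one>\<^bsub>R\<^esub> \<in> arr A FR N" using rmod_hom_closed[OF h, of "\<one>\<^bsub>R\<^esub>"] by (simp add: HomF_simps)
  ultimately show "\<exists>b\<in>arr A FR N. \<forall>m\<in>carrier RR. Comp A FR FR N b (orbit_arrow RR m) = h m"
    by (intro bexI[of _ "h \<one>\<^bsub>R\<^esub>"]) simp_all
qed

text \<open>
  An arrow out of \<open>FP\<close> is recovered from its restrictions along \<open>F i\<close> and \<open>F j\<close>, because \<open>F\<close> preserves the
  equation \<open>i \<circ> p + j \<circ> q = 1\<close>.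
\<close>
lemma F_identity_of_sum:
  assumes M: "M \<in> Obj C" and N: "N \<in> Obj C" and P: "P \<in> Obj C"
    and i: "i \<in> rmod_hom R M P" and j: "j \<in> rmod_hom R N P"
    and p: "p \<in> rmod_hom R P M" and q: "q \<in> rmod_hom R P N"
    and id: "\<forall>x\<in>carrier P. i (p x) \<oplus>\<^bsub>P\<^esub> j (q x) = x"
    and X: "X \<in> Obj A" and b: "b \<in> arr A (FObj F P) X"
  shows "b =
    Comp A (FObj F P) (FObj F M) X (Comp A (FObj F M) (FObj F P) X b (FMap F M P i)) (FMap F P M p)
    \<oplus>\<^bsub>Hom A (FObj F P) X\<^esub>
    Comp A (FObj F P) (FObj F N) X (Comp A (FObj F N) (FObj F P) X b (FMap F N P j)) (FMap F P N q)"
proof -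
  note o = F_obj[OF M] F_obj[OF N] F_obj[OF P]
  note a = F_map[OF M P i] F_map[OF N P j] F_map[OF P M p] F_map[OF P N q]
  note ip = rmod_hom_compose[OF C_module[OF P] p i] and jq = rmod_hom_compose[OF C_module[OF P] q j]
  have "(\<lambda>x\<in>carrier P. x) =
      (\<lambda>x\<in>carrier P. compose (carrier P) i p x \<oplus>\<^bsub>P\<^esub> compose (carrier P) j q x)"
    by (rule restrict_ext) (simp add: compose_def id)
  then have "Idt A (FObj F P) =
      FMap F P P (\<lambda>x\<in>carrier P. compose (carrier P) i p x \<oplus>\<^bsub>P\<^esub> compose (carrier P) j q x)"
    using F_id[OF P] by (simp only:)
  also have "\<dots> =
      Comp A (FObj F P) (FObj F M) (FObj F P) (FMap F M P i) (FMap F P M p)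
      \<oplus>\<^bsub>Hom A (FObj F P) (FObj F P)\<^esub>
      Comp A (FObj F P) (FObj F N) (FObj F P) (FMap F N P j) (FMap F P N q)"
    unfolding F_add[OF P P ip jq] F_comp[OF P M P p i] F_comp[OF P N P q j] by (rule refl)
  finally have id_sum: "Idt A (FObj F P) = \<dots>" .
  have "b = Comp A (FObj F P) (FObj F P) X b (Idt A (FObj F P))"
    by (rule A.Comp_Idt[OF o(3) X b, symmetric])
  then show ?thesis
    unfolding id_sum
      A.Comp_add_right[OF o(3,3) X A.Comp_closed[OF o(3,1,3) a(3,1)] A.Comp_closed[OF o(3,2,3) a(4,2)] b]
      A.Comp_assoc[OF o(3,1,3) X a(3,1) b] A.Comp_assoc[OF o(3,2,3) X a(4,2) b] .
qed

lemma determined_pair: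
  assumes e: "inj e" and M: "M \<in> Obj C" and N: "N \<in> Obj C" and PO: "pair_module e M N \<in> Obj C"
    and dM: "determined M" and dN: "determined N"
  shows "determined (pair_module e M N)"
proof (rule determinedI[OF PO])
  define P where "P = pair_module e M N"
  fix X b b' assume X: "X \<in> Obj A"
    and "b \<in> arr A (FObj F (pair_module e M N)) X" "b' \<in> arr A (FObj F (pair_module e M N)) X"
    and "\<And>m. m \<in> carrier (pair_module e M N) \<Longrightarrow>
      Comp A FR (FObj F (pair_module e M N)) X b (orbit_arrow (pair_module e M N) m) =
      Comp A FR (FObj F (pair_module e M N)) X b' (orbit_arrow (pair_module e M N) m)"
  then have b: "b \<in> arr A (FObj F P) X" and b': "b' \<in> arr A (FObj F P) X"
    and eq: "\<And>m. m \<in> carrier P \<Longrightarrow> Comp A FR (FObj F P) X b (orbit_arrow P m) = Comp A FR (FObj F P) X b' (orbit_arrow P m)"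
    by (simp_all add: P_def)
  have P: "P \<in> Obj C" using PO by (simp add: P_def)
  have restr: "Comp A (FObj F Y) (FObj F P) X b (FMap F Y P f) = Comp A (FObj F Y) (FObj F P) X b' (FMap F Y P f)"
    if Y: "Y \<in> Obj C" "determined Y" and f: "f \<in> rmod_hom R Y P" for Y f
  proof (rule determinedD[OF Y(2) X])
    note cl = A.Comp_closed[OF F_obj[OF Y(1)] F_obj[OF P] X F_map[OF Y(1) P f]]
    show "Comp A (FObj F Y) (FObj F P) X b (FMap F Y P f) \<in> arr A (FObj F Y) X" by (rule cl[OF b])
    show "Comp A (FObj F Y) (FObj F P) X b' (FMap F Y P f) \<in> arr A (FObj F Y) X" by (rule cl[OF b'])
    fix y assume y: "y \<in> carrier Y"
    show "Comp A FR (FObj F Y) X (Comp A (FObj F Y) (FObj F P) X b (FMap F Y P f)) (orbit_arrow Y y) =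
        Comp A FR (FObj F Y) X (Comp A (FObj F Y) (FObj F P) X b' (FMap F Y P f)) (orbit_arrow Y y)"
      unfolding Comp_F_orbit_arrow[OF Y(1) P f X b y] Comp_F_orbit_arrow[OF Y(1) P f X b' y]
      by (rule eq[OF rmod_hom_closed[OF f y]])
  qed
  obtain i j p q where ij: "i \<in> rmod_hom R M P" "j \<in> rmod_hom R N P" and pq: "p \<in> rmod_hom R P M" "q \<in> rmod_hom R P N"
      and id: "\<And>x. x \<in> carrier P \<Longrightarrow> i (p x) \<oplus>\<^bsub>P\<^esub> j (q x) = x"
    by (rule pair_module_identity[OF C_module[OF M] C_module[OF N] e P_def]) blast
  have "\<forall>x\<in>carrier P. i (p x) \<oplus>\<^bsub>P\<^esub> j (q x) = x" using id by simp
  note dec = F_identity_of_sum[OF M N P ij pq this X]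
  show "b = b'"
    by (rule trans[OF dec[OF b] trans[OF _ dec[OF b', symmetric]]])
       (simp only: restr[OF M dM ij(1)] restr[OF N dN ij(2)])
qed

text \<open>Representing arrows for \<open>h \<circ> i\<close> and \<open>h \<circ> j\<close> add up to one for \<open>h\<close>, after composition with \<open>F p\<close> and \<open>F q\<close>.\<close>
lemma representable_pair:
  assumes e: "inj e" and M: "M \<in> Obj C" and N: "N \<in> Obj C" and PO: "pair_module e M N \<in> Obj C"
    and rM: "representable M" and rN: "representable N"
  shows "representable (pair_module e M N)"
proof (rule representableI)
  show "determined (pair_module e M N)"
    using rM rN by (intro determined_pair e M N PO) (simp_all add: representable_def)
  define P where "P = pair_module e M N"
  fix X h assume X: "X \<in> Obj A" and "h \<in> rmod_hom R (pair_module e M N) (HomF X)"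
  then have h: "h \<in> rmod_hom R P (HomF X)" by (simp add: P_def)
  have P: "P \<in> Obj C" using PO by (simp add: P_def)
  interpret P: right_module R P by (rule C_module[OF P])
  obtain i j p q where i: "i \<in> rmod_hom R M P" and j: "j \<in> rmod_hom R N P"
      and p: "p \<in> rmod_hom R P M" and q: "q \<in> rmod_hom R P N"
      and id: "\<And>x. x \<in> carrier P \<Longrightarrow> i (p x) \<oplus>\<^bsub>P\<^esub> j (q x) = x"
    by (rule pair_module_identity[OF C_module[OF M] C_module[OF N] e P_def]) blast
  obtain b1 where b1: "b1 \<in> arr A (FObj F M) X"
      "\<And>m. m \<in> carrier M \<Longrightarrow> Comp A FR (FObj F M) X b1 (orbit_arrow M m) = compose (carrier M) h i m"
    by (rule representableD[OF rM X rmod_hom_compose[OF C_module[OF M] i h]]) blast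
  obtain b2 where b2: "b2 \<in> arr A (FObj F N) X"
      "\<And>m. m \<in> carrier N \<Longrightarrow> Comp A FR (FObj F N) X b2 (orbit_arrow N m) = compose (carrier N) h j m"
    by (rule representableD[OF rN X rmod_hom_compose[OF C_module[OF N] j h]]) blast
  note o = F_obj[OF RR_Obj] F_obj[OF P] F_obj[OF M] F_obj[OF N]
  let ?c1 = "Comp A (FObj F P) (FObj F M) X b1 (FMap F P M p)"
  let ?c2 = "Comp A (FObj F P) (FObj F N) X b2 (FMap F P N q)"
  have c: "?c1 \<in> arr A (FObj F P) X" "?c2 \<in> arr A (FObj F P) X"
    by (rule A.Comp_closed[OF o(2,3) X F_map[OF P M p] b1(1)], rule A.Comp_closed[OF o(2,4) X F_map[OF P N q] b2(1)])
  have "Comp A FR (FObj F P) X (?c1 \<oplus>\<^bsub>Hom A (FObj F P) X\<^esub> ?c2) (orbit_arrow P x) = h x"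
    if x: "x \<in> carrier P" for x
  proof -
    have "Comp A FR (FObj F P) X (?c1 \<oplus>\<^bsub>Hom A (FObj F P) X\<^esub> ?c2) (orbit_arrow P x) =
        h (i (p x)) \<oplus>\<^bsub>HomF X\<^esub> h (j (q x))"
      using A.Comp_add_left[OF o(1,2) X orbit_arrow_closed[OF P x] c] b1(2) b2(2)
        Comp_F_orbit_arrow[OF P M p X b1(1) x] Comp_F_orbit_arrow[OF P N q X b2(1) x]
        rmod_hom_closed[OF p x] rmod_hom_closed[OF q x] by (simp add: compose_def HomF_simps)
    also have "\<dots> = h x"
      using rmod_hom_add[OF h rmod_hom_closed[OF i rmod_hom_closed[OF p x]]
          rmod_hom_closed[OF j rmod_hom_closed[OF q x]]] id[OF x] by simp
    finally show ?thesis .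
  qed
  moreover have "?c1 \<oplus>\<^bsub>Hom A (FObj F P) X\<^esub> ?c2 \<in> arr A (FObj F P) X"
    by (rule A.Hom_add_closed[OF o(2) X c])
  ultimately show "\<exists>b\<in>arr A (FObj F (pair_module e M N)) X. \<forall>m\<in>carrier (pair_module e M N).
      Comp A FR (FObj F (pair_module e M N)) X b (orbit_arrow (pair_module e M N) m) = h m"
    unfolding P_def[symmetric] by (intro bexI ballI)
qed

lemma kernel_sequence:
  assumes P: "P \<in> Obj C" and M: "M \<in> Obj C" and f: "f \<in> rmod_hom R P M"
    and surj: "f ` carrier P = carrier M"
  obtains K where "K \<in> Obj C" "(\<lambda>x\<in>carrier K. x) \<in> rmod_hom R K P"
    "\<And>x. x \<in> carrier K \<Longrightarrow> x \<in> carrier P \<and> f x = \<zero>\<^bsub>M\<^esub>"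
    "exact_at A (FObj F K) (FObj F P) (FObj F M) (FMap F K P (\<lambda>x\<in>carrier K. x)) (FMap F P M f)"
    "epic A (FObj F P) (FObj F M) (FMap F P M f)"
proof -
  define K where "K = P\<lparr>carrier := {p \<in> carrier P. f p = \<zero>\<^bsub>M\<^esub>}\<rparr>"
  have small: "carrier P \<in> U" "carrier M \<in> U" using P M by (simp_all add: Mod_Obj)
  have "carrier K \<in> U" by (rule small_subset[OF U small(1)]) (auto simp: K_def)
  note K = exact_inclusion_of_kernel(1,3,4)[OF C_module[OF P] C_module[OF M] f surj K_def small this, where \<gamma> = \<gamma>]
    and k = exact_inclusion_of_kernel(2)[OF C_module[OF P] C_module[OF M] f surj K_def small this]
  have ex: "exact_at A (FObj F K) (FObj F P) (FObj F M) (FMap F K P (\<lambda>x\<in>carrier K. x)) (FMap F P M f) \<and>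
      epic A (FObj F P) (FObj F M) (FMap F P M f)"
    using F_right_exact K P M by (simp add: right_exact_def)
  show ?thesis by (rule that[OF K(1) k _ conjunct1[OF ex] conjunct2[OF ex]]) (simp add: K_def)
qed

text \<open>The arrow \<open>F f\<close> is epic and maps orbit arrows to orbit arrows.\<close>
lemma determined_image:
  assumes P: "P \<in> Obj C" and M: "M \<in> Obj C" and f: "f \<in> rmod_hom R P M"
    and surj: "f ` carrier P = carrier M" and d: "determined P"
  shows "determined M"
proof (rule determinedI[OF M])
  fix X b b' assume X: "X \<in> Obj A" and b: "b \<in> arr A (FObj F M) X" and b': "b' \<in> arr A (FObj F M) X"
    and eq: "\<And>m. m \<in> carrier M \<Longrightarrow> Comp A FR (FObj F M) X b (orbit_arrow M m) = Comp A FR (FObj F M) X b' (orbit_arrow M m)"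
  note cl = A.Comp_closed[OF F_obj[OF P] F_obj[OF M] X F_map[OF P M f]]
  have "Comp A (FObj F P) (FObj F M) X b (FMap F P M f) = Comp A (FObj F P) (FObj F M) X b' (FMap F P M f)"
  proof (rule determinedD[OF d X cl[OF b] cl[OF b']])
    fix p assume p: "p \<in> carrier P"
    show "Comp A FR (FObj F P) X (Comp A (FObj F P) (FObj F M) X b (FMap F P M f)) (orbit_arrow P p) =
        Comp A FR (FObj F P) X (Comp A (FObj F P) (FObj F M) X b' (FMap F P M f)) (orbit_arrow P p)"
      unfolding Comp_F_orbit_arrow[OF P M f X b p] Comp_F_orbit_arrow[OF P M f X b' p]
      by (rule eq[OF rmod_hom_closed[OF f p]])
  qed
  moreover have "epic A (FObj F P) (FObj F M) (FMap F P M f)"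
    by (rule kernel_sequence[OF P M f surj])
  ultimately show "b = b'" using X b b' by (simp add: epic_def)
qed

text \<open>
  The arrow \<open>t : FP \<rightarrow> X\<close> that represents \<open>h \<circ> f\<close> descends to \<open>FM\<close> because it kills \<open>FK\<close>: the latter can be tested on the
  orbit arrows of \<open>K\<close>, where it holds as \<open>h \<circ> f\<close> vanishes on \<open>K\<close>.
\<close>
lemma representable_image:
  assumes P: "P \<in> Obj C" and M: "M \<in> Obj C" and f: "f \<in> rmod_hom R P M"
    and surj: "f ` carrier P = carrier M" and r: "representable P"
    and det: "\<And>K. K \<in> Obj C \<Longrightarrow> determined K"
  shows "representable M"
proof (rule representableI[OF det[OF M]])
  fix X h assume X: "X \<in> Obj A" and h: "h \<in> rmod_hom R M (HomF X)"
  obtain K where K: "K \<in> Obj C" and k: "(\<lambda>x\<in>carrier K. x) \<in> rmod_hom R K P"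
    and cK: "\<And>x. x \<in> carrier K \<Longrightarrow> x \<in> carrier P \<and> f x = \<zero>\<^bsub>M\<^esub>"
    and ex: "exact_at A (FObj F K) (FObj F P) (FObj F M) (FMap F K P (\<lambda>x\<in>carrier K. x)) (FMap F P M f)"
    and epi: "epic A (FObj F P) (FObj F M) (FMap F P M f)"
    by (rule kernel_sequence[OF P M f surj]) blast
  obtain t where t: "t \<in> arr A (FObj F P) X"
      "\<And>x. x \<in> carrier P \<Longrightarrow> Comp A FR (FObj F P) X t (orbit_arrow P x) = compose (carrier P) h f x"
    by (rule representableD[OF r X rmod_hom_compose[OF C_module[OF P] f h]]) blast
  note o = F_obj[OF RR_Obj] F_obj[OF K] F_obj[OF P] F_obj[OF M]
  interpret H: abelian_group "Hom A FR X" by (rule A.Hom_group[OF o(1) X])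
  interpret M: right_module R M by (rule C_module[OF M])
  have h0: "h \<zero>\<^bsub>M\<^esub> = \<zero>\<^bsub>Hom A FR X\<^esub>"
    using rmod_hom_add[OF h M.M.zero_closed M.M.zero_closed] rmod_hom_closed[OF h M.M.zero_closed]
    by (intro A.Hom_idem_zero[OF o(1) X]) (simp_all add: HomF_simps)
  have "Comp A (FObj F K) (FObj F P) X t (FMap F K P (\<lambda>x\<in>carrier K. x)) = \<zero>\<^bsub>Hom A (FObj F K) X\<^esub>"
  proof (rule determinedD[OF det[OF K] X])
    fix x assume x: "x \<in> carrier K"
    show "Comp A FR (FObj F K) X (Comp A (FObj F K) (FObj F P) X t (FMap F K P (\<lambda>x\<in>carrier K. x))) (orbit_arrow K x) =
        Comp A FR (FObj F K) X \<zero>\<^bsub>Hom A (FObj F K) X\<^esub> (orbit_arrow K x)"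
      using Comp_F_orbit_arrow[OF K P k X t(1) x] t(2)[of x] cK[OF x] x h0
        A.Comp_zero_left[OF o(1,2) X orbit_arrow_closed[OF K x]] by (simp add: compose_def)
  qed (rule A.Comp_closed[OF o(2,3) X F_map[OF K P k] t(1)], rule A.Hom_zero_closed[OF o(2) X])
  from A.exact_epic_factor[OF o(2,3,4) X ex epi t(1) this]
  obtain b where b: "b \<in> arr A (FObj F M) X" "Comp A (FObj F P) (FObj F M) X b (FMap F P M f) = t"
    by (elim bexE)
  have "Comp A FR (FObj F M) X b (orbit_arrow M m) = h m" if m: "m \<in> carrier M" for m
  proof -
    obtain x where x: "x \<in> carrier P" "m = f x" using m unfolding surj[symmetric] by (elim imageE)
    then show ?thesis using Comp_F_orbit_arrow[OF P M f X b(1) x(1)] b(2) t(2)[OF x(1)] by (simp add: compose_def)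
  qed
  then show "\<exists>b\<in>arr A (FObj F M) X. \<forall>m\<in>carrier M. Comp A FR (FObj F M) X b (orbit_arrow M m) = h m"
    using b(1) by (intro bexI ballI)
qed

lemma direct_limitD:
  assumes "directed_system C I r X t" "is_direct_limit C I r X t M c"
  shows "M \<in> Obj C" "\<And>i. i \<in> I \<Longrightarrow> X i \<in> Obj C" "\<And>i. i \<in> I \<Longrightarrow> c i \<in> rmod_hom R (X i) M"
    "\<And>i j. (i, j) \<in> r \<Longrightarrow> i \<in> I \<and> j \<in> I \<and> t i j \<in> rmod_hom R (X i) (X j) \<and>
      compose (carrier (X i)) (c j) (t i j) = c i"
proof -
  have "partial_order_on I r" using assms(1) by (simp add: directed_system_def)
  then have "r \<subseteq> I \<times> I" by (simp add: partial_order_on_def preorder_on_def)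
  then show "\<And>i j. (i, j) \<in> r \<Longrightarrow> i \<in> I \<and> j \<in> I \<and> t i j \<in> rmod_hom R (X i) (X j) \<and>
      compose (carrier (X i)) (c j) (t i j) = c i"
    using assms by (auto simp: directed_system_def is_direct_limit_def is_cocone_def)
qed (use assms in \<open>auto simp: directed_system_def is_direct_limit_def is_cocone_def\<close>)

lemma F_limit:
  assumes "I \<in> U" "directed_system C I r X t" "is_direct_limit C I r X t M c"
  shows "is_direct_limit A I r (\<lambda>i. FObj F (X i)) (\<lambda>i j. FMap F (X i) (X j) (t i j))
    (FObj F M) (\<lambda>i. FMap F (X i) M (c i))"
  using F_limits assms by (simp add: preserves_direct_limits_def)

lemma F_limit_ex1:
  assumes "I \<in> U" "directed_system C I r X t" "is_direct_limit C I r X t M c"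
    and "is_cocone A I r (\<lambda>i. FObj F (X i)) (\<lambda>i j. FMap F (X i) (X j) (t i j)) Z d"
  shows "\<exists>!b. b \<in> arr A (FObj F M) Z \<and>
    (\<forall>i\<in>I. Comp A (FObj F (X i)) (FObj F M) Z b (FMap F (X i) M (c i)) = d i)"
  using F_limit[OF assms(1-3)] assms(4) by (simp add: is_direct_limit_def)

text \<open>Both arrows induce the same cocone on the objects \<open>F (X i)\<close>, whose direct limit is \<open>FM\<close>.\<close>
lemma determined_limit:
  assumes I: "I \<in> U" and sys: "directed_system C I r X t" and lim: "is_direct_limit C I r X t M c"
    and d: "\<And>i. i \<in> I \<Longrightarrow> determined (X i)"
  shows "determined M"
proof (rule determinedI)
  note D = direct_limitD[OF sys lim]
  show M: "M \<in> Obj C" by (rule D(1))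
  fix Z b b' assume Z: "Z \<in> Obj A" and b: "b \<in> arr A (FObj F M) Z" and b': "b' \<in> arr A (FObj F M) Z"
    and eq: "\<And>m. m \<in> carrier M \<Longrightarrow> Comp A FR (FObj F M) Z b (orbit_arrow M m) = Comp A FR (FObj F M) Z b' (orbit_arrow M m)"
  let ?r = "\<lambda>b i. Comp A (FObj F (X i)) (FObj F M) Z b (FMap F (X i) M (c i))"
  have cl: "?r b'' i \<in> arr A (FObj F (X i)) Z" if "i \<in> I" "b'' \<in> arr A (FObj F M) Z" for i b''
    using that by (intro A.Comp_closed F_obj Z M F_map D(2,3))
  have same: "?r b i = ?r b' i" if i: "i \<in> I" for i
  proof (rule determinedD[OF d[OF i] Z cl[OF i b] cl[OF i b']])
    fix x assume x: "x \<in> carrier (X i)"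
    show "Comp A FR (FObj F (X i)) Z (?r b i) (orbit_arrow (X i) x) = Comp A FR (FObj F (X i)) Z (?r b' i) (orbit_arrow (X i) x)"
      unfolding Comp_F_orbit_arrow[OF D(2)[OF i] M D(3)[OF i] Z b x] Comp_F_orbit_arrow[OF D(2)[OF i] M D(3)[OF i] Z b' x]
      by (rule eq[OF rmod_hom_closed[OF D(3)[OF i] x]])
  qed
  have "is_cocone A I r (\<lambda>i. FObj F (X i)) (\<lambda>i j. FMap F (X i) (X j) (t i j)) Z (?r b)"
    unfolding is_cocone_def
  proof (intro conjI Z ballI, goal_cases)
    case (1 i) then show ?case by (rule cl[OF _ b])
  next
    case (2 z)
    obtain i j where z: "z = (i, j)" by (cases z)
    note ij = D(4)[OF 2[unfolded z]]
    have i: "i \<in> I" and j: "j \<in> I" and tij: "t i j \<in> rmod_hom R (X i) (X j)"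
      and cij: "compose (carrier (X i)) (c j) (t i j) = c i" using ij by simp_all
    show ?case
      using A.Comp_assoc[OF F_obj[OF D(2)[OF i]] F_obj[OF D(2)[OF j]] F_obj[OF M] Z
          F_map[OF D(2)[OF i] D(2)[OF j] tij] F_map[OF D(2)[OF j] M D(3)[OF j]] b]
        F_comp[OF D(2)[OF i] D(2)[OF j] M tij D(3)[OF j]] cij
      by (simp add: z)
  qed
  from F_limit_ex1[OF I sys lim this]
  show "b = b'" by (rule ex1E) (use b b' same in metis)
qed

text \<open>
  The representing arrows at the stages form a cocone since they are unique.  Joint surjectivity of the
  structure maps ensures that the induced arrow has the right value on every orbit arrow of \<open>M\<close>.
\<close>
lemma representable_limit:
  assumes I: "I \<in> U" and sys: "directed_system C I r X t" and lim: "is_direct_limit C I r X t M c"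
    and cover: "\<And>m. m \<in> carrier M \<Longrightarrow> \<exists>i\<in>I. m \<in> c i ` carrier (X i)"
    and rep: "\<And>i. i \<in> I \<Longrightarrow> representable (X i)"
  shows "representable M"
proof (rule representableI)
  note D = direct_limitD[OF sys lim]
  have M: "M \<in> Obj C" by (rule D(1))
  have d: "determined (X i)" if "i \<in> I" for i using rep[OF that] by (simp add: representable_def)
  show "determined M" by (rule determined_limit[OF I sys lim d])
  fix Z h assume Z: "Z \<in> Obj A" and h: "h \<in> rmod_hom R M (HomF Z)"
  define \<beta> where "\<beta> i = (SOME b. b \<in> arr A (FObj F (X i)) Z \<and>
      (\<forall>x\<in>carrier (X i). Comp A FR (FObj F (X i)) Z b (orbit_arrow (X i) x) = h (c i x)))" for i
  have \<beta>: "\<beta> i \<in> arr A (FObj F (X i)) Z \<and>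
      (\<forall>x\<in>carrier (X i). Comp A FR (FObj F (X i)) Z (\<beta> i) (orbit_arrow (X i) x) = h (c i x))"
    if i: "i \<in> I" for i
  proof -
    obtain b where "b \<in> arr A (FObj F (X i)) Z"
        "\<And>x. x \<in> carrier (X i) \<Longrightarrow> Comp A FR (FObj F (X i)) Z b (orbit_arrow (X i) x) = compose (carrier (X i)) h (c i) x"
      by (rule representableD[OF rep[OF i] Z rmod_hom_compose[OF C_module[OF D(2)[OF i]] D(3)[OF i] h]]) blast
    then have "b \<in> arr A (FObj F (X i)) Z \<and>
      (\<forall>x\<in>carrier (X i). Comp A FR (FObj F (X i)) Z b (orbit_arrow (X i) x) = h (c i x))"
      by (simp add: compose_def)
    then show ?thesis unfolding \<beta>_def by (rule someI)
  qed
  have "is_cocone A I r (\<lambda>i. FObj F (X i)) (\<lambda>i j. FMap F (X i) (X j) (t i j)) Z \<beta>"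
    unfolding is_cocone_def
  proof (intro conjI Z ballI, goal_cases)
    case (1 i) then show ?case using \<beta> by simp
  next
    case (2 z)
    obtain i j where z: "z = (i, j)" by (cases z)
    note ij = D(4)[OF 2[unfolded z]]
    have i: "i \<in> I" and j: "j \<in> I" and tij: "t i j \<in> rmod_hom R (X i) (X j)"
      and cij: "compose (carrier (X i)) (c j) (t i j) = c i" using ij by simp_all
    have "Comp A (FObj F (X i)) (FObj F (X j)) Z (\<beta> j) (FMap F (X i) (X j) (t i j)) = \<beta> i"
    proof (rule determinedD[OF d[OF i] Z])
      fix x assume x: "x \<in> carrier (X i)"
      have "c j (t i j x) = c i x" using fun_cong[OF cij, of x] x by (simp add: compose_def)
      then show "Comp A FR (FObj F (X i)) Z
          (Comp A (FObj F (X i)) (FObj F (X j)) Z (\<beta> j) (FMap F (X i) (X j) (t i j))) (orbit_arrow (X i) x) =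
          Comp A FR (FObj F (X i)) Z (\<beta> i) (orbit_arrow (X i) x)"
        using Comp_F_orbit_arrow[OF D(2)[OF i] D(2)[OF j] tij Z _ x, of "\<beta> j"] \<beta>[OF i] \<beta>[OF j] x
          rmod_hom_closed[OF tij x] by simp
    next
      show "Comp A (FObj F (X i)) (FObj F (X j)) Z (\<beta> j) (FMap F (X i) (X j) (t i j)) \<in> arr A (FObj F (X i)) Z"
        using \<beta>[OF j] by (intro A.Comp_closed[OF F_obj[OF D(2)[OF i]] F_obj[OF D(2)[OF j]] Z
          F_map[OF D(2)[OF i] D(2)[OF j] tij]]) simp
      show "\<beta> i \<in> arr A (FObj F (X i)) Z" using \<beta>[OF i] by simp
    qed
    then show ?case by (simp add: z)
  qed
  from ex1_implies_ex[OF F_limit_ex1[OF I sys lim this]]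
  obtain b where b: "b \<in> arr A (FObj F M) Z"
      and "\<forall>i\<in>I. Comp A (FObj F (X i)) (FObj F M) Z b (FMap F (X i) M (c i)) = \<beta> i"
    by (elim exE conjE)
  then have b\<beta>: "Comp A (FObj F (X i)) (FObj F M) Z b (FMap F (X i) M (c i)) = \<beta> i" if "i \<in> I" for i
    using that by (elim bspec)
  have "Comp A FR (FObj F M) Z b (orbit_arrow M m) = h m" if m: "m \<in> carrier M" for m
  proof -
    obtain i x where x: "i \<in> I" "x \<in> carrier (X i)" "m = c i x" using cover[OF m] by (elim bexE imageE)
    then show ?thesis
      using Comp_F_orbit_arrow[OF D(2)[OF x(1)] M D(3)[OF x(1)] Z b x(2)] b\<beta>[OF x(1)] \<beta>[OF x(1)] x(2,3) by simp
  qed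
  then show "\<exists>b\<in>arr A (FObj F M) Z. \<forall>m\<in>carrier M. Comp A FR (FObj F M) Z b (orbit_arrow M m) = h m"
    using b by (intro bexI ballI)
qed

lemma all_determined:
  assumes "M \<in> Obj C" shows "determined M"
  using U small_ring assms
proof (induction rule: module_induct)
  case regular show ?case by (rule determined_regular)
next
  case (pair e M N) then show ?case by (rule determined_pair)
next
  case (image M N f) then show ?case by (rule determined_image)
next
  case (limit I r X t M c) show ?case by (rule determined_limit[OF limit(1,2,3,5)])
qed

lemma all_representable:
  assumes "M \<in> Obj C" shows "representable M"
  using U small_ring assms
proof (induction rule: module_induct)
  case regular show ?case by (rule representable_regular)
next
  case (pair e M N) then show ?case by (rule representable_pair)
next
  case (image M N f) then show ?case by (rule representable_image[OF _ _ _ _ _ all_determined])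
next
  case (limit I r X t M c) then show ?case by (rule representable_limit)
qed

text \<open>
  That \<open>Hom\<^sub>A (FR, -)\<close> is a functor is part of the notion of adjointness; in the application it comes with
  the given tensor functor.
\<close>
lemma F_left_adjoint:
  assumes "is_functor A (Mod R \<gamma> UNIV) (Hom_functor A (FR, \<rho>))"
  shows "is_left_adjoint C (Mod R \<gamma> UNIV) A F (Hom_functor A (FR, \<rho>))"
  unfolding is_left_adjoint_iff
proof (intro conjI F_functor assms exI)
  show "adjunction C (Mod R \<gamma> UNIV) A F (Hom_functor A (FR, \<rho>)) transpose"
    unfolding adjunction_def Mod_simps
  proof (intro conjI ballI)
    fix M N assume M: "M \<in> Obj C" and N: "N \<in> Obj A"
    show "bij_betw (transpose M N) (arr A (FObj F M) N) (rmod_hom R M (HomF N))"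
    proof (rule bij_betw_imageI)
      show "inj_on (transpose M N) (arr A (FObj F M) N)"
        using all_determined[OF M] N by (simp add: determined_def)
      show "transpose M N ` arr A (FObj F M) N = rmod_hom R M (HomF N)"
        using all_representable[OF M] N transpose_rmod_hom[OF M N]
        by (intro subset_antisym) (auto simp: representable_def)
    qed
  next
    fix M M' N u g assume M: "M \<in> Obj C" and M': "M' \<in> Obj C" and N: "N \<in> Obj A"
      and u: "u \<in> rmod_hom R M' M" and g: "g \<in> arr A (FObj F M) N"
    show "transpose M' N (Comp A (FObj F M') (FObj F M) N g (FMap F M' M u)) =
        compose (carrier M') (transpose M N g) u"
      unfolding transpose_def compose_def
      using Comp_F_orbit_arrow[OF M' M u N g] rmod_hom_closed[OF u] by (intro restrict_ext) simp
  next
    fix M N N' h g assume M: "M \<in> Obj C" and N: "N \<in> Obj A" and N': "N' \<in> Obj A"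
      and h: "h \<in> arr A N N'" and g: "g \<in> arr A (FObj F M) N"
    note o = F_obj[OF RR_Obj] F_obj[OF M]
    show "transpose M N' (Comp A (FObj F M) N N' h g) =
        compose (carrier M) (FMap (Hom_functor A (FR, \<rho>)) N N' h) (transpose M N g)"
      unfolding transpose_def compose_def
    proof (rule restrict_ext)
      fix m assume m: "m \<in> carrier M"
      note gm = orbit_arrow_closed[OF M m]
      show "Comp A FR (FObj F M) N' (Comp A (FObj F M) N N' h g) (orbit_arrow M m) =
          FMap (Hom_functor A (FR, \<rho>)) N N' h ((\<lambda>m\<in>carrier M. Comp A FR (FObj F M) N g (orbit_arrow M m)) m)"
        using A.Comp_assoc[OF o N N' gm g h] A.Comp_closed[OF o N gm g] m by (simp add: HomF_simps)
    qed
  qed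
qed

end

theorem proposition3p2:
  fixes k :: "('k, 'z) ring_scheme"
    and R :: "('u, 'y) ring_scheme"
    and \<gamma> :: "'k \<Rightarrow> 'u"
    and U :: "'u set set"
    and A :: "('k, 'o, 'u) cat"
    and F :: "(('u, 'u) module, 'u \<Rightarrow> 'u, 'o, 'u) func"
  defines "FR \<equiv> FObj F (regular_module R)"
    and "\<rho> \<equiv> (\<lambda>x. FMap F (regular_module R) (regular_module R) (left_mult R x))"
  assumes "small_universe U"
    and "cring k"
    and "k_algebra k R \<gamma>" and "carrier R \<in> U"
    and "abelian_category A" and "linear_category k A" and "cocomplete U A"
    and "F \<in> Bk k U (Mod R \<gamma> U) A"
  shows "(FR, \<rho>) \<in> left_modules_in k R \<gamma> A \<and>
    (\<forall>T. is_tensor_functor R \<gamma> U A (FR, \<rho>) T \<longrightarrow>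
       (\<exists>\<eta>. natural_iso (Mod R \<gamma> U) A F T \<eta>))"
proof -
  interpret F: right_exact_limit_functor k R \<gamma> U A F
    using assms(3,5,6,7,10) by (rule right_exact_limit_functor.intro)
  have \<rho>: "F.\<rho> = \<rho>" by (rule ext) (simp add: F.\<rho>_def \<rho>_def)
  have "\<exists>\<eta>. natural_iso (Mod R \<gamma> U) A F T \<eta>"
    if T: "is_left_adjoint (Mod R \<gamma> U) (Mod R \<gamma> UNIV) A T (Hom_functor A (FR, \<rho>))" for T
  proof -
    have "is_functor A (Mod R \<gamma> UNIV) (Hom_functor A (FR, \<rho>))"
      using T by (simp add: is_left_adjoint_def)
    then have "is_left_adjoint (Mod R \<gamma> U) (Mod R \<gamma> UNIV) A F (Hom_functor A (FR, \<rho>))"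
      using F.F_left_adjoint unfolding \<rho> FR_def by simp
    from left_adjoint_unique[OF F.A.category_axioms this T] show ?thesis .
  qed
  then show ?thesis
    using F.regular_ring_left_module unfolding \<rho> FR_def is_tensor_functor_def by simp
qed

end
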